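(* Let $X$ be a topological space and $Y$ be a metrizable, connected and locally arcwise connected space. Then $\mathrm{K}_1(X,Y)\cap\Sigma^f(X,Y)=\mathrm{B}_1(X,Y)$.
   Context: Functionally closed/open sets: zero sets of continuous functions $X\to[0,1]$, resp. their complements; functionally $F_\sigma$: countable union of functionally closed sets. $\mathrm{K}_1(X,Y)$: mappings $f:X\to Y$ with $f^{-1}(V)$ functionally $F_\sigma$ for every open $V\subseteq Y$. A family $(A_i:i\in I)$ of subsets of $X$ is strongly functionally discrete (sfd) if there is a discrete family $(U_i:i\in I)$ of functionally open sets with $\overline{A_i}\subseteq U_i$ for all $i$; $\sigma$-sfd means a countable union of sfd families. A family $\mathcal B$ is a base for $f$ if each $f^{-1}(V)$, $V\subseteq Y$ open, is a union of members of $\mathcal B$. $\Sigma^f(X,Y)$: mappings $X\to Y$ having a $\sigma$-sfd base. $\mathrm{B}_1(X,Y)$: pointwise limits of sequences of continuous mappings $X\to Y$. *)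

theory Defs
  imports "HOL-Analysis.Analysis"
begin

definition arcin :: "'a topology \<Rightarrow> (real \<Rightarrow> 'a) \<Rightarrow> bool" where
  "arcin X g \<equiv> embedding_map (subtopology euclideanreal {0..1}) X g"

definition arc_connected_space :: "'a topology \<Rightarrow> bool" where
  "arc_connected_space X \<equiv>
     \<forall>x \<in> topspace X. \<forall>y \<in> topspace X. x \<noteq> y \<longrightarrow>
        (\<exists>g. arcin X g \<and> g 0 = x \<and> g 1 = y)"

definition arc_connectedin :: "'a topology \<Rightarrow> 'a set \<Rightarrow> bool" where
  "arc_connectedin X S \<equiv> S \<subseteq> topspace X \<and> arc_connected_space (subtopology X S)"

definition locally_arc_connected_space :: "'a topology \<Rightarrow> bool" where
  "locally_arc_connected_space X \<equiv> neighbourhood_base_of (arc_connectedin X) X"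

definition functionally_closed :: "'a topology \<Rightarrow> 'a set \<Rightarrow> bool" where
  "functionally_closed X A \<equiv>
     \<exists>f. continuous_map X (subtopology euclideanreal {0..1}) f \<and>
         A = {x \<in> topspace X. f x = 0}"

definition functionally_open :: "'a topology \<Rightarrow> 'a set \<Rightarrow> bool" where
  "functionally_open X A \<equiv> A \<subseteq> topspace X \<and> functionally_closed X (topspace X - A)"

definition functionally_Fsigma :: "'a topology \<Rightarrow> 'a set \<Rightarrow> bool" where
  "functionally_Fsigma X A \<equiv>
     \<exists>F :: nat \<Rightarrow> 'a set. (\<forall>n. functionally_closed X (F n)) \<and> A = (\<Union>n. F n)"

definition K1 :: "'a topology \<Rightarrow> 'b topology \<Rightarrow> ('a \<Rightarrow> 'b) set" where
  "K1 X Y = {f. f \<in> topspace X \<rightarrow> topspace Y \<and>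
       (\<forall>V. openin Y V \<longrightarrow> functionally_Fsigma X {x \<in> topspace X. f x \<in> V})}"

definition discrete_family :: "'a topology \<Rightarrow> ('i \<Rightarrow> 'a set) \<Rightarrow> 'i set \<Rightarrow> bool" where
  "discrete_family X U I \<equiv>
     \<forall>x \<in> topspace X. \<exists>W. openin X W \<and> x \<in> W \<and>
        (\<forall>i \<in> I. \<forall>j \<in> I. W \<inter> U i \<noteq> {} \<and> W \<inter> U j \<noteq> {} \<longrightarrow> i = j)"

definition sfd_family :: "'a topology \<Rightarrow> ('i \<Rightarrow> 'a set) \<Rightarrow> 'i set \<Rightarrow> bool" where
  "sfd_family X A I \<equiv>
     \<exists>U. discrete_family X U I \<and>
         (\<forall>i \<in> I. functionally_open X (U i) \<and> X closure_of (A i) \<subseteq> U i)"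

definition sfd :: "'a topology \<Rightarrow> 'a set set \<Rightarrow> bool" where
  "sfd X \<B> \<equiv> sfd_family X (\<lambda>B. B) \<B>"

definition sigma_sfd :: "'a topology \<Rightarrow> 'a set set \<Rightarrow> bool" where
  "sigma_sfd X \<B> \<equiv> \<exists>\<F> :: nat \<Rightarrow> 'a set set. (\<forall>n. sfd X (\<F> n)) \<and> \<B> = (\<Union>n. \<F> n)"

definition base_for :: "'a topology \<Rightarrow> 'b topology \<Rightarrow> ('a \<Rightarrow> 'b) \<Rightarrow> 'a set set \<Rightarrow> bool" where
  "base_for X Y f \<B> \<equiv>
     \<forall>V. openin Y V \<longrightarrow> (\<exists>\<C> \<subseteq> \<B>. {x \<in> topspace X. f x \<in> V} = \<Union>\<C>)"

definition Sigma_f :: "'a topology \<Rightarrow> 'b topology \<Rightarrow> ('a \<Rightarrow> 'b) set" where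
  "Sigma_f X Y = {f. f \<in> topspace X \<rightarrow> topspace Y \<and>
       (\<exists>\<B>. sigma_sfd X \<B> \<and> base_for X Y f \<B>)}"

definition B1 :: "'a topology \<Rightarrow> 'b topology \<Rightarrow> ('a \<Rightarrow> 'b) set" where
  "B1 X Y = {f. f \<in> topspace X \<rightarrow> topspace Y \<and>
       (\<exists>g :: nat \<Rightarrow> 'a \<Rightarrow> 'b. (\<forall>n. continuous_map X Y (g n)) \<and>
          (\<forall>x \<in> topspace X. limitin Y (\<lambda>n. g n x) (f x) sequentially))}"

end

(*
A pointwise limit f of continuous maps g_n satisfies f x : V iff g_n x stays in some member of a
countable exhaustion of V by functionally closed sets for all large n; applied to the members of a
sigma-discrete base of Y, uniformly separated on each level, the sets where this holds from index k
on form a sigma-sfd base for f.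

Conversely, suppose f is in K1 and has a sigma-sfd base. At each scale 2^-m there are functionally
closed sets D_{m,n} that eventually contain every point of X as n grows, and maps, locally constant
near D_{m,n}, whose value at x : D_{m,n} can be joined to f x inside a path connected set of
diameter at most 2^-m. For fixed n one starts with a constant map and corrects it successively at
the scales m < n by moving its values along short paths towards the next locally constant map, with
a functionally separating function as time parameter. Corrections at later scales are summably
small, so the resulting continuous map is within 5 * 2^-m of f on the intersection of the D_{l,n}
with l < m. Completeness of Y is not needed, since only finitely many corrections are made for
each n.
*)
theory Submission
  imports Defs
begin

section \<open>Functionally closed and functionally open sets\<close>

text \<open>The obstacle is continuity of the corrected maps: joining two moving points by a path
  would demand a continuous choice of paths. Keeping both endpoints locally constant removes it,
  since one path chosen for each pair of values then serves a whole open set. Discreteness of the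
  sigma-sfd base supplies the local constancy; membership in \<open>K1\<close> supplies the
  functionally closed pieces on which the approximation is good. Being joined inside a small set
  replaces small distance throughout, because a small distance in \<open>Y\<close> gives no bound,
  uniform in the points, on the size of a connecting path. \<open>X\<close> is an arbitrary space,
  so Urysohn functions are available only between zero sets and cozero sets: every set that is built
  has to be shown functionally closed or open, and unions over large index sets are controlled by
  discreteness.\<close>

lemma continuous_map_locally_eq:
  assumes "\<And>x. x \<in> topspace X \<Longrightarrow> \<exists>W h. openin X W \<and> x \<in> W \<and> continuous_map X Y h \<and> (\<forall>y\<in>W. g y = h y)"
  shows "continuous_map X Y g"
  unfolding continuous_map_eq_topcontinuous_at topcontinuous_at_def
proof (intro ballI conjI allI impI)
  fix x assume x: "x \<in> topspace X"
  then obtain W h where W: "openin X W" "x \<in> W" "continuous_map X Y h" "\<And>y. y \<in> W \<Longrightarrow> g y = h y"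
    using assms[OF x] by blast
  show "g \<in> topspace X \<rightarrow> topspace Y"
  proof
    fix y assume y: "y \<in> topspace X"
    then obtain W h where "y \<in> W" "continuous_map X Y h" "\<forall>y\<in>W. g y = h y"
      using assms[OF y] by blast
    then show "g y \<in> topspace Y"
      using continuous_map_funspace[of X Y h] y by auto
  qed
  fix V assume V: "openin Y V \<and> g x \<in> V"
  have "openin X (W \<inter> {y \<in> topspace X. h y \<in> V})"
    using W V by (intro openin_Int openin_continuous_map_preimage) auto
  moreover have "x \<in> W \<inter> {y \<in> topspace X. h y \<in> V}"
    using W V x by auto
  ultimately show "\<exists>U. openin X U \<and> x \<in> U \<and> (\<forall>y\<in>U. g y \<in> V)"
    using W(4) by (intro exI[of _ "W \<inter> {y \<in> topspace X. h y \<in> V}"]) auto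
qed assumption

lemma functionally_closed_zero_set:
  assumes "continuous_map X euclideanreal f"
  shows "functionally_closed X {x \<in> topspace X. f x = 0}"
proof -
  have "continuous_map X (top_of_set {0..1}) (\<lambda>x. min 1 \<bar>f x\<bar>)"
    by (auto simp: continuous_map_in_subtopology intro!: continuous_intros assms)
  moreover have "{x \<in> topspace X. f x = 0} = {x \<in> topspace X. min 1 \<bar>f x\<bar> = 0}"
    by (auto simp: min_def)
  ultimately show ?thesis
    unfolding functionally_closed_def by blast
qed

lemma functionally_closed_le:
  assumes "continuous_map X euclideanreal f"
  shows "functionally_closed X {x \<in> topspace X. f x \<le> c}"
proof -
  have "continuous_map X euclideanreal (\<lambda>x. max 0 (f x - c))"
    by (auto intro!: continuous_intros assms)
  moreover have "{x \<in> topspace X. f x \<le> c} = {x \<in> topspace X. max 0 (f x - c) = 0}"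
    by auto
  ultimately show ?thesis
    using functionally_closed_zero_set by metis
qed

lemma functionally_closed_ge:
  assumes "continuous_map X euclideanreal f"
  shows "functionally_closed X {x \<in> topspace X. c \<le> f x}"
  using functionally_closed_le[of X "\<lambda>x. - f x" "- c"] continuous_map_minus[OF assms] by simp

lemma functionally_closedE:
  assumes "functionally_closed X A"
  obtains h where "continuous_map X euclideanreal h" "\<And>x. x \<in> topspace X \<Longrightarrow> 0 \<le> h x \<and> h x \<le> 1"
    "A = {x \<in> topspace X. h x = 0}"
  using assms unfolding functionally_closed_def continuous_map_in_subtopology by fastforce

lemma functionally_closed_subset: "functionally_closed X A \<Longrightarrow> A \<subseteq> topspace X"
  by (auto simp: functionally_closed_def)

lemma functionally_open_gr:
  assumes "continuous_map X euclideanreal f"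
  shows "functionally_open X {x \<in> topspace X. c < f x}"
proof -
  have "topspace X - {x \<in> topspace X. c < f x} = {x \<in> topspace X. f x \<le> c}"
    by auto
  with functionally_closed_le[OF assms] show ?thesis
    by (simp add: functionally_open_def)
qed

lemma functionally_openE:
  assumes "functionally_open X A"
  obtains h where "continuous_map X euclideanreal h" "\<And>x. x \<in> topspace X \<Longrightarrow> 0 \<le> h x \<and> h x \<le> 1"
    "A = {x \<in> topspace X. 0 < h x}"
proof -
  obtain h where h: "continuous_map X euclideanreal h" "\<And>x. x \<in> topspace X \<Longrightarrow> 0 \<le> h x \<and> h x \<le> 1"
    "topspace X - A = {x \<in> topspace X. h x = 0}"
    by (rule functionally_closedE[OF assms[unfolded functionally_open_def, THEN conjunct2]]) (rule that)
  have "x \<in> A \<longleftrightarrow> h x \<noteq> 0" if "x \<in> topspace X" for x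
    using h(3) that by (simp add: set_eq_iff) blast
  moreover have "A \<subseteq> topspace X"
    using assms by (simp add: functionally_open_def)
  ultimately have "A = {x \<in> topspace X. 0 < h x}"
    using h(2) by (auto simp: less_le)
  with h that show ?thesis by blast
qed

lemma functionally_open_imp_openin:
  assumes "functionally_open X A"
  shows "openin X A"
proof -
  obtain h where h: "continuous_map X euclideanreal h" "A = {x \<in> topspace X. 0 < h x}"
    using assms functionally_openE by metis
  show ?thesis
    using openin_continuous_map_preimage[OF h(1), of "{0<..}"] h(2) by auto
qed

lemma functionally_open_Diff:
  assumes "functionally_closed X A"
  shows "functionally_open X (topspace X - A)"
  using assms functionally_closed_subset[OF assms] by (simp add: functionally_open_def double_diff)

lemma functionally_open_topspace: "functionally_open X (topspace X)"
  using functionally_open_gr[of X "\<lambda>x. 1" 0] by simp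

lemma functionally_closed_topspace: "functionally_closed X (topspace X)"
  using functionally_closed_le[of X "\<lambda>x. 0" 0] by simp

lemma functionally_open_Int:
  assumes "functionally_open X A" "functionally_open X B"
  shows "functionally_open X (A \<inter> B)"
proof -
  obtain a where a: "continuous_map X euclideanreal a" "A = {x \<in> topspace X. 0 < a x}"
    using assms functionally_openE by metis
  obtain b where b: "continuous_map X euclideanreal b" "B = {x \<in> topspace X. 0 < b x}"
    using assms functionally_openE by metis
  have "continuous_map X euclideanreal (\<lambda>x. min (a x) (b x))"
    by (intro continuous_intros a b)
  from functionally_open_gr[OF this, of 0] show ?thesis
    by (simp add: a b Int_def conj_ac)
qed

lemma functionally_open_Un:
  assumes "functionally_open X A" "functionally_open X B"
  shows "functionally_open X (A \<union> B)"
proof -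
  obtain a where a: "continuous_map X euclideanreal a" "A = {x \<in> topspace X. 0 < a x}"
    using assms functionally_openE by metis
  obtain b where b: "continuous_map X euclideanreal b" "B = {x \<in> topspace X. 0 < b x}"
    using assms functionally_openE by metis
  have "continuous_map X euclideanreal (\<lambda>x. max (a x) (b x))"
    by (intro continuous_intros a b)
  from functionally_open_gr[OF this, of 0]
  have "functionally_open X {x \<in> topspace X. 0 < max (a x) (b x)}" .
  moreover have "A \<union> B = {x \<in> topspace X. 0 < max (a x) (b x)}"
    by (auto simp: a b)
  ultimately show ?thesis by simp
qed

lemma functionally_closed_Int:
  assumes "functionally_closed X A" "functionally_closed X B"
  shows "functionally_closed X (A \<inter> B)"
proof -
  have "topspace X - (A \<inter> B) = (topspace X - A) \<union> (topspace X - B)"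
    by auto
  moreover have "functionally_open X (topspace X - A)" "functionally_open X (topspace X - B)"
    by (simp_all add: assms functionally_open_Diff)
  ultimately have "functionally_open X (topspace X - (A \<inter> B))"
    using functionally_open_Un by metis
  then show ?thesis
    using functionally_closed_subset[OF assms(1)]
    by (simp add: functionally_open_def double_diff le_infI1)
qed

lemma functionally_closed_Un:
  assumes "functionally_closed X A" "functionally_closed X B"
  shows "functionally_closed X (A \<union> B)"
proof -
  have "topspace X - (A \<union> B) = (topspace X - A) \<inter> (topspace X - B)"
    by auto
  moreover have "functionally_open X (topspace X - A)" "functionally_open X (topspace X - B)"
    by (simp_all add: assms functionally_open_Diff)
  ultimately have "functionally_open X (topspace X - (A \<union> B))"
    using functionally_open_Int by metis
  then show ?thesis
    using functionally_closed_subset[OF assms(1)] functionally_closed_subset[OF assms(2)]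
    by (simp add: functionally_open_def double_diff)
qed

lemma functionally_open_UN_finite:
  assumes "finite I" "\<And>i. i \<in> I \<Longrightarrow> functionally_open X (A i)"
  shows "functionally_open X (\<Union>i\<in>I. A i)"
  using assms
proof (induction I)
  case empty
  then show ?case
    by (simp add: functionally_open_def functionally_closed_topspace)
qed (auto intro: functionally_open_Un)

lemma functionally_closed_UN_finite:
  assumes "finite I" "\<And>i. i \<in> I \<Longrightarrow> functionally_closed X (A i)"
  shows "functionally_closed X (\<Union>i\<in>I. A i)"
  using assms
proof (induction I)
  case empty
  then show ?case
    using functionally_open_topspace by (simp add: functionally_open_def)
qed (auto intro: functionally_closed_Un)

lemma functionally_closed_INT_finite:
  assumes "finite I" "\<And>i. i \<in> I \<Longrightarrow> functionally_closed X (A i)"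
  shows "functionally_closed X (topspace X \<inter> (\<Inter>i\<in>I. A i))"
  using assms
proof (induction I)
  case empty
  then show ?case
    by (simp add: functionally_closed_topspace)
next
  case (insert i I)
  then have "functionally_closed X (A i \<inter> (topspace X \<inter> (\<Inter>i\<in>I. A i)))"
    by (intro functionally_closed_Int insert.IH insert.prems) auto
  then show ?case
    by (simp add: Int_left_commute)
qed

text \<open>The sum of the defining functions with weights 2^-n converges uniformly, hence is
  continuous, and a sum of nonnegative terms vanishes exactly where every term does.\<close>

lemma functionally_closed_INT:
  fixes A :: "nat \<Rightarrow> 'a set"
  assumes "\<And>n. functionally_closed X (A n)"
  shows "functionally_closed X (\<Inter>n. A n)"
proof -
  have "\<exists>h. continuous_map X euclideanreal h \<and> (\<forall>x\<in>topspace X. 0 \<le> h x \<and> h x \<le> 1)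
      \<and> A n = {x \<in> topspace X. h x = 0}" for n
    using functionally_closedE[OF assms[of n]] by metis
  then have "\<forall>n. \<exists>h. continuous_map X euclideanreal h \<and> (\<forall>x\<in>topspace X. 0 \<le> h x \<and> h x \<le> 1)
      \<and> A n = {x \<in> topspace X. h x = 0}"
    by (rule allI)
  from choice[OF this] obtain h where "\<forall>n. continuous_map X euclideanreal (h n) \<and>
      (\<forall>x\<in>topspace X. 0 \<le> h n x \<and> h n x \<le> 1) \<and> A n = {x \<in> topspace X. h n x = 0}"
    by (rule exE)
  then have h: "\<And>n. continuous_map X euclideanreal (h n)"
    "\<And>n x. x \<in> topspace X \<Longrightarrow> 0 \<le> h n x \<and> h n x \<le> 1"
    "\<And>n. A n = {x \<in> topspace X. h n x = 0}"
    by blast+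
  define s where "s x = (\<Sum>n. (1/2)^n * h n x)" for x
  have bound: "norm ((1/2)^n * h n x) \<le> (1/2)^n" if "x \<in> topspace X" for n x
    using h(2)[OF that, of n] by (simp add: abs_mult mult_left_le)
  have geo: "summable (\<lambda>n. (1/2)^n :: real)"
    by (rule summable_geometric) simp
  have sm: "summable (\<lambda>n. (1/2)^n * h n x)" if "x \<in> topspace X" for x
    by (rule summable_comparison_test'[OF geo, of 0]) (use bound that in auto)
  have ul: "uniform_limit (topspace X) (\<lambda>N x. \<Sum>n<N. (1/2)^n * h n x) s sequentially"
    unfolding s_def by (rule Weierstrass_m_test[OF bound geo])
  have "continuous_map X Met_TC.mtopology s"
  proof (rule Met_TC.continuous_map_uniform_limit[where f="\<lambda>N x. \<Sum>n<N. (1/2)^n * h n x" and F=sequentially])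
    show "\<forall>\<^sub>F N in sequentially. continuous_map X Met_TC.mtopology (\<lambda>x. \<Sum>n<N. (1/2)^n * h n x)"
      by (intro always_eventually allI) (simp add: continuous_map_sum continuous_map_real_mult h(1))
    show "\<forall>\<^sub>F N in sequentially. \<forall>x\<in>topspace X. s x \<in> UNIV \<and> dist (\<Sum>n<N. (1/2)^n * h n x) (s x) < e"
      if "0 < e" for e
      using uniform_limitD[OF ul that] by simp
  qed auto
  then have "continuous_map X euclideanreal s"
    by simp
  moreover have "(\<Inter>n. A n) = {x \<in> topspace X. s x = 0}"
  proof -
    have "s x = 0 \<longleftrightarrow> (\<forall>n. h n x = 0)" if "x \<in> topspace X" for x
      unfolding s_def using suminf_eq_zero_iff[OF sm[OF that]] h(2)[OF that] by simp
    then show ?thesis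
      by (auto simp: h(3))
  qed
  ultimately show ?thesis
    using functionally_closed_zero_set by metis
qed

lemma functionally_closed_INT_atLeast:
  fixes A :: "nat \<Rightarrow> 'a set"
  assumes "\<And>n. functionally_closed X (A n)"
  shows "functionally_closed X (\<Inter>n\<in>{k..}. A n)"
proof -
  have "(\<Inter>n\<in>{k..}. A n) = (\<Inter>n. A (k + n))"
    by (auto simp: le_iff_add)
  then show ?thesis
    using functionally_closed_INT[of X "\<lambda>n. A (k + n)"] assms by simp
qed

text \<open>With \<open>A\<close> the zero set of \<open>a\<close> and \<open>U\<close> the set
  where \<open>u\<close> is positive, the quotient u / (a + u) works: the denominator vanishes
  nowhere because \<open>A\<close> lies in \<open>U\<close>. This takes the place of Urysohn's
  lemma.\<close>

lemma functional_separation: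
  assumes "functionally_closed X A" "functionally_open X U" "A \<subseteq> U"
  obtains p where "continuous_map X euclideanreal p" "\<And>x. x \<in> topspace X \<Longrightarrow> 0 \<le> p x \<and> p x \<le> 1"
    "A = {x \<in> topspace X. p x = 1}" "U = {x \<in> topspace X. 0 < p x}"
proof -
  obtain a where a: "continuous_map X euclideanreal a" "\<And>x. x \<in> topspace X \<Longrightarrow> 0 \<le> a x \<and> a x \<le> 1"
    "A = {x \<in> topspace X. a x = 0}"
    using functionally_closedE[OF assms(1)] by metis
  obtain u where u: "continuous_map X euclideanreal u" "\<And>x. x \<in> topspace X \<Longrightarrow> 0 \<le> u x \<and> u x \<le> 1"
    "U = {x \<in> topspace X. 0 < u x}"
    using functionally_openE[OF assms(2)] by metis
  have pos: "0 < a x + u x" if "x \<in> topspace X" for x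
    using a(2)[OF that] u(2)[OF that] assms(3) that
    by (cases "x \<in> A") (auto simp: a(3) u(3))
  have "continuous_map X euclideanreal (\<lambda>x. u x / (a x + u x))"
    by (intro continuous_intros a u) (use pos in force)
  moreover have "0 \<le> u x / (a x + u x) \<and> u x / (a x + u x) \<le> 1" if "x \<in> topspace X" for x
    using a(2)[OF that] u(2)[OF that] pos[OF that] by (simp add: divide_simps)
  moreover have "A = {x \<in> topspace X. u x / (a x + u x) = 1}"
    using pos by (force simp: a(3) field_simps)
  moreover have "U = {x \<in> topspace X. 0 < u x / (a x + u x)}"
    using pos by (auto simp: u(3) zero_less_divide_iff) (smt (verit) pos)+
  ultimately show ?thesis
    using that by blast
qed

section \<open>Functionally F_sigma sets\<close>

lemma functionally_closed_imp_Fsigma: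
  "functionally_closed X A \<Longrightarrow> functionally_Fsigma X A"
  unfolding functionally_Fsigma_def by (intro exI[of _ "\<lambda>_. A"]) auto

lemma functionally_Fsigma_UN:
  fixes A :: "nat \<Rightarrow> 'a set"
  assumes "\<And>n. functionally_Fsigma X (A n)"
  shows "functionally_Fsigma X (\<Union>n. A n)"
proof -
  have "\<forall>n. \<exists>F :: nat \<Rightarrow> 'a set. (\<forall>m. functionally_closed X (F m)) \<and> A n = (\<Union>m. F m)"
    using assms unfolding functionally_Fsigma_def by blast
  from choice[OF this] obtain F
    where "\<forall>n. (\<forall>m :: nat. functionally_closed X (F n m)) \<and> A n = (\<Union>m. F n m)" by (rule exE)
  then have F: "functionally_closed X (F n m)" "A n = (\<Union>m. F n m)" for n m
    by simp_all
  have "(\<Union>n. A n) = (\<Union>k. case prod_decode k of (n, m) \<Rightarrow> F n m)" (is "?L = ?R")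
  proof
    show "?L \<subseteq> ?R"
    proof
      fix x assume "x \<in> ?L"
      then obtain n m where "x \<in> F n m"
        using F by auto
      then show "x \<in> ?R"
        by (intro UN_I[of "prod_encode (n, m)"]) auto
    qed
    show "?R \<subseteq> ?L"
      by (auto simp: F split: prod.splits)
  qed
  moreover have "functionally_closed X (case prod_decode k of (n, m) \<Rightarrow> F n m)" for k
    by (auto simp: F split: prod.splits)
  ultimately show ?thesis
    unfolding functionally_Fsigma_def
    by (intro exI[of _ "\<lambda>k. case prod_decode k of (n, m) \<Rightarrow> F n m"]) simp
qed

lemma functionally_Fsigma_Int:
  assumes "functionally_Fsigma X A" "functionally_Fsigma X B"
  shows "functionally_Fsigma X (A \<inter> B)"
proof -
  obtain F G where F: "\<And>n :: nat. functionally_closed X (F n)" "A = (\<Union>n. F n)"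
    and G: "\<And>n :: nat. functionally_closed X (G n)" "B = (\<Union>n. G n)"
    using assms unfolding functionally_Fsigma_def by blast
  have "A \<inter> B = (\<Union>n. \<Union>m. F n \<inter> G m)"
    by (auto simp: F G)
  moreover have "functionally_Fsigma X (\<Union>n. \<Union>m. F n \<inter> G m)"
    by (intro functionally_Fsigma_UN functionally_closed_imp_Fsigma functionally_closed_Int F G)
  ultimately show ?thesis
    by simp
qed

lemma functionally_open_imp_Fsigma:
  assumes "functionally_open X A"
  shows "functionally_Fsigma X A"
proof -
  obtain h where h: "continuous_map X euclideanreal h" "A = {x \<in> topspace X. 0 < h x}"
    using functionally_openE[OF assms] by metis
  have "A = (\<Union>n. {x \<in> topspace X. 1 / real (Suc n) \<le> h x})"
  proof (intro set_eqI iffI)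
    fix x assume "x \<in> A"
    then have x: "x \<in> topspace X" "0 < h x"
      by (auto simp: h(2))
    obtain n where "1 / real (Suc n) < h x"
      using nat_approx_posE[OF x(2)] by blast
    then show "x \<in> (\<Union>n. {x \<in> topspace X. 1 / real (Suc n) \<le> h x})"
      using x(1) by (intro UN_I[of n]) auto
  next
    fix x assume "x \<in> (\<Union>n. {x \<in> topspace X. 1 / real (Suc n) \<le> h x})"
    then obtain n where "x \<in> topspace X" "1 / real (Suc n) \<le> h x"
      by blast
    moreover have "0 < 1 / real (Suc n)"
      by simp
    ultimately show "x \<in> A"
      unfolding h(2) by (blast intro: less_le_trans)
  qed
  moreover have "functionally_closed X {x \<in> topspace X. 1 / real (Suc n) \<le> h x}" for n
    by (rule functionally_closed_ge[OF h(1)])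
  ultimately show ?thesis
    unfolding functionally_Fsigma_def
    by (intro exI[of _ "\<lambda>n. {x \<in> topspace X. 1 / real (Suc n) \<le> h x}"]) simp
qed

section \<open>Discrete families and relatively clopen pieces\<close>

lemma discrete_familyE:
  assumes "discrete_family X U I" "x \<in> topspace X"
  obtains W where "openin X W" "x \<in> W"
    "\<And>i j. i \<in> I \<Longrightarrow> j \<in> I \<Longrightarrow> W \<inter> U i \<noteq> {} \<Longrightarrow> W \<inter> U j \<noteq> {} \<Longrightarrow> i = j"
proof -
  obtain W where W: "openin X W \<and> x \<in> W \<and>
      (\<forall>i \<in> I. \<forall>j \<in> I. W \<inter> U i \<noteq> {} \<and> W \<inter> U j \<noteq> {} \<longrightarrow> i = j)"
    using assms(1)[unfolded discrete_family_def, THEN bspec, OF assms(2)] by (rule exE)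
  show ?thesis
    by (rule that[of W]) (use W in simp_all)
qed

lemma discrete_family_unique:
  assumes "discrete_family X U I" "x \<in> topspace X" "i \<in> I" "j \<in> I" "x \<in> U i" "x \<in> U j"
  shows "i = j"
  using assms unfolding discrete_family_def by (metis IntI empty_iff)

lemma discrete_family_mono:
  assumes "discrete_family X U I" "J \<subseteq> I" "\<And>i. i \<in> J \<Longrightarrow> V i \<subseteq> U i"
  shows "discrete_family X V J"
  unfolding discrete_family_def
proof
  fix x assume "x \<in> topspace X"
  then obtain W where W: "openin X W" "x \<in> W"
    "\<And>i j. i \<in> I \<Longrightarrow> j \<in> I \<Longrightarrow> W \<inter> U i \<noteq> {} \<Longrightarrow> W \<inter> U j \<noteq> {} \<Longrightarrow> i = j"
    using discrete_familyE[OF assms(1)] by metis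
  have "i = j" if "i \<in> J" "j \<in> J" "W \<inter> V i \<noteq> {}" "W \<inter> V j \<noteq> {}" for i j
    by (rule W(3)) (use that assms(2,3) in blast)+
  then show "\<exists>W. openin X W \<and> x \<in> W \<and> (\<forall>i\<in>J. \<forall>j\<in>J. W \<inter> V i \<noteq> {} \<and> W \<inter> V j \<noteq> {} \<longrightarrow> i = j)"
    using W(1,2) by (intro exI[of _ W]) simp
qed

text \<open>Near each point at most one of the separating functions is nonzero, so their pointwise
  supremum is continuous.\<close>
lemma discrete_union_separation:
  assumes disc: "discrete_family X U I"
    and U: "\<And>i. i \<in> I \<Longrightarrow> functionally_open X (U i)"
    and F: "\<And>i. i \<in> I \<Longrightarrow> functionally_closed X (F i)"
    and FU: "\<And>i. i \<in> I \<Longrightarrow> F i \<subseteq> U i"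
  shows "functionally_closed X (\<Union>i\<in>I. F i)" "functionally_open X (\<Union>i\<in>I. U i)"
proof -
  have "\<exists>p. continuous_map X euclideanreal p \<and> (\<forall>x\<in>topspace X. 0 \<le> p x \<and> p x \<le> 1)
      \<and> F i = {x \<in> topspace X. p x = 1} \<and> U i = {x \<in> topspace X. 0 < p x}" if "i \<in> I" for i
    by (rule functional_separation[OF F U FU, OF that that that]) blast
  then have "\<forall>i\<in>I. \<exists>p. continuous_map X euclideanreal p \<and> (\<forall>x\<in>topspace X. 0 \<le> p x \<and> p x \<le> 1)
      \<and> F i = {x \<in> topspace X. p x = 1} \<and> U i = {x \<in> topspace X. 0 < p x}"
    by blast
  from bchoice[OF this] obtain p where p: "\<And>i. i \<in> I \<Longrightarrow> continuous_map X euclideanreal (p i)"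
    "\<And>i x. i \<in> I \<Longrightarrow> x \<in> topspace X \<Longrightarrow> 0 \<le> p i x \<and> p i x \<le> (1::real)"
    "\<And>i. i \<in> I \<Longrightarrow> F i = {x \<in> topspace X. p i x = 1}"
    "\<And>i. i \<in> I \<Longrightarrow> U i = {x \<in> topspace X. 0 < p i x}"
    by blast
  \<comment> \<open>At most one index has \<open>x\<close> in \<open>U i\<close>, so the description
    is unique; the default 0 agrees with the value of every \<open>p i\<close> outside
    \<open>U i\<close>.\<close>
  define q where "q x = (if \<exists>i\<in>I. x \<in> U i then p (THE i. i \<in> I \<and> x \<in> U i) x else 0)" for x
  have q: "q x = p i x" if "x \<in> topspace X" "i \<in> I" "x \<in> U i" for x i
  proof -
    have "(THE i. i \<in> I \<and> x \<in> U i) = i"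
      using discrete_family_unique[OF disc that(1)] that by blast
    then show ?thesis
      using that by (auto simp: q_def)
  qed
  have q0: "q x = 0" if "\<And>i. i \<in> I \<Longrightarrow> x \<notin> U i" for x
    using that by (auto simp: q_def)
  have cont: "continuous_map X euclideanreal q"
  proof (rule continuous_map_locally_eq)
    fix x assume x: "x \<in> topspace X"
    obtain W where W: "openin X W" "x \<in> W"
      "\<And>i j. i \<in> I \<Longrightarrow> j \<in> I \<Longrightarrow> W \<inter> U i \<noteq> {} \<Longrightarrow> W \<inter> U j \<noteq> {} \<Longrightarrow> i = j"
      using discrete_familyE[OF disc x] by metis
    have WX: "W \<subseteq> topspace X"
      using W(1) openin_subset by blast
    show "\<exists>W h. openin X W \<and> x \<in> W \<and> continuous_map X euclideanreal h \<and> (\<forall>y\<in>W. q y = h y)"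
    proof (cases "\<exists>i\<in>I. W \<inter> U i \<noteq> {}")
      case True
      then obtain i where i: "i \<in> I" "W \<inter> U i \<noteq> {}" by blast
      have "q y = p i y" if y: "y \<in> W" for y
      proof (cases "y \<in> U i")
        case True
        then show ?thesis
          using y WX q i(1) by blast
      next
        case False
        then have "\<not> 0 < p i y"
          using p(4)[OF i(1)] y WX by blast
        then have "p i y = 0"
          using p(2)[OF i(1), of y] y WX by force
        moreover have "q y = 0"
        proof (rule q0)
          fix j assume "j \<in> I"
          then show "y \<notin> U j"
            using W(3)[OF i(1) \<open>j \<in> I\<close> i(2)] False y by auto
        qed
        ultimately show ?thesis by simp
      qed
      with W(1,2) p(1)[OF i(1)] show ?thesis by blast
    next
      case False
      then have "q y = 0" if "y \<in> W" for y
        using that by (intro q0) auto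
      with W(1,2) show ?thesis
        by (intro exI[of _ W] exI[of _ "\<lambda>_. 0"]) simp
    qed
  qed
  have "(\<Union>i\<in>I. F i) = {x \<in> topspace X. 1 \<le> q x}"
  proof (intro set_eqI iffI)
    fix x assume "x \<in> (\<Union>i\<in>I. F i)"
    then obtain i where "i \<in> I" "x \<in> F i" by blast
    then show "x \<in> {x \<in> topspace X. 1 \<le> q x}"
      using q[of x i] FU[of i] p(3)[of i] by auto
  next
    fix x assume x: "x \<in> {x \<in> topspace X. 1 \<le> q x}"
    then obtain i where i: "i \<in> I" "x \<in> U i"
      using q0[of x] by force
    then have "p i x = 1"
      using q[of x i] p(2)[OF i(1), of x] x by simp
    then show "x \<in> (\<Union>i\<in>I. F i)"
      using p(3)[OF i(1)] i x by blast
  qed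
  then show "functionally_closed X (\<Union>i\<in>I. F i)"
    using functionally_closed_ge[OF cont] by simp
  have "(\<Union>i\<in>I. U i) = {x \<in> topspace X. 0 < q x}"
  proof (intro set_eqI iffI)
    fix x assume "x \<in> (\<Union>i\<in>I. U i)"
    then obtain i where "i \<in> I" "x \<in> U i" by blast
    then show "x \<in> {x \<in> topspace X. 0 < q x}"
      using q[of x i] p(4)[of i] by auto
  next
    fix x assume "x \<in> {x \<in> topspace X. 0 < q x}"
    then show "x \<in> (\<Union>i\<in>I. U i)"
      using q0[of x] by force
  qed
  then show "functionally_open X (\<Union>i\<in>I. U i)"
    using functionally_open_gr[OF cont] by simp
qed

lemma functionally_open_INT_finite:
  assumes "finite I" "functionally_open X B" "\<And>i. i \<in> I \<Longrightarrow> functionally_open X (A i)"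
  shows "functionally_open X (B \<inter> (\<Inter>i\<in>I. A i))"
  using assms(1,3)
proof (induction I)
  case empty
  with assms(2) show ?case by simp
next
  case (insert i I)
  then have "functionally_open X (A i \<inter> (B \<inter> (\<Inter>i\<in>I. A i)))"
    by (intro functionally_open_Int insert.IH insert.prems) auto
  then show ?case
    by (simp add: Int_left_commute)
qed

text \<open>\<open>V\<close> is clopen relative to \<open>U\<close>, so a function defining
  \<open>U\<close> may be cut off to 0 on \<open>U - V\<close>. The cut-off function stays
  continuous at the boundary of \<open>U\<close> because the original one already tends to 0 there;
  this is checked through upper and lower semicontinuity.\<close>

lemma functionally_open_clopen_part:
  assumes U: "functionally_open X U" and V: "V \<subseteq> U" "openin X V" "openin X (U - V)"
  shows "functionally_open X V"
proof -
  obtain h where h: "continuous_map X euclideanreal h" "\<And>x. x \<in> topspace X \<Longrightarrow> 0 \<le> h x \<and> h x \<le> 1"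
    "U = {x \<in> topspace X. 0 < h x}"
    using functionally_openE[OF U] by metis
  define k where "k x = (if x \<in> V then h x else 0)" for x
  have VX: "V \<subseteq> topspace X"
    using V(2) openin_subset by blast
  have "openin X {x \<in> topspace X. c < k x}" for c
  proof (cases "0 \<le> c")
    case True
    have "{x \<in> topspace X. c < k x} = V \<inter> {x \<in> topspace X. h x \<in> {c<..}}"
      using True VX by (auto simp: k_def split: if_splits)
    then show ?thesis
      using openin_Int[OF V(2) openin_continuous_map_preimage[OF h(1), of "{c<..}"]] by simp
  next
    case False
    then have "{x \<in> topspace X. c < k x} = topspace X"
      using h(2) by (force simp: k_def)
    then show ?thesis by simp
  qed
  moreover have "openin X {x \<in> topspace X. k x < c}" for c
  proof (cases "0 < c")
    case True
    have "{x \<in> topspace X. k x < c} = {x \<in> topspace X. h x \<in> {..<c}} \<union> (U - V)"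
      using True h(2,3) by (auto simp: k_def split: if_splits)
    then show ?thesis
      using openin_Un[OF openin_continuous_map_preimage[OF h(1), of "{..<c}"] V(3)] by simp
  next
    case False
    then have "{x \<in> topspace X. k x < c} = {}"
      using h(2) by (force simp: k_def)
    then show ?thesis by (simp only: openin_empty)
  qed
  ultimately have "continuous_map X euclideanreal k"
    unfolding continuous_map_upper_lower_semicontinuous_lt by blast
  moreover have "V = {x \<in> topspace X. 0 < k x}"
    using V(1) by (auto simp: k_def h(3))
  ultimately show ?thesis
    using functionally_open_gr by metis
qed

section \<open>Pointwise limits of continuous maps\<close>

lemma functionally_open_preimage:
  assumes "continuous_map X Y g" "functionally_open Y V"
  shows "functionally_open X {x \<in> topspace X. g x \<in> V}"
proof -
  obtain h where h: "continuous_map Y euclideanreal h" "V = {y \<in> topspace Y. 0 < h y}"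
    using functionally_openE[OF assms(2)] by metis
  have "continuous_map X euclideanreal (h \<circ> g)"
    using assms(1) h(1) by (rule continuous_map_compose)
  moreover have "{x \<in> topspace X. g x \<in> V} = {x \<in> topspace X. 0 < (h \<circ> g) x}"
    using continuous_map_funspace[OF assms(1)] by (auto simp: h(2))
  ultimately show ?thesis
    using functionally_open_gr by metis
qed

text \<open>The distance to the complement of \<open>V\<close> is 1-Lipschitz and positive exactly
  on \<open>V\<close>. The case \<open>V = M\<close> stands apart because the infimum would run over
  the empty set.\<close>

lemma (in Metric_space) functionally_open_mtopology:
  assumes V: "openin mtopology V"
  shows "functionally_open mtopology V"
proof (cases "V = M")
  case True
  then show ?thesis
    using functionally_open_topspace[of mtopology] by simp
next
  case False
  have VM: "V \<subseteq> M"
    using V openin_subset by fastforce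
  define S where "S = M - V"
  have S: "S \<noteq> {}" "S \<subseteq> M"
    using False VM by (auto simp: S_def)
  define h where "h y = (INF s\<in>S. d y s)" for y
  have bdd: "bdd_below (d y ` S)" for y
    by (rule bdd_belowI2[where m=0]) simp
  have lip: "h x \<le> d x y + h y" if "x \<in> M" "y \<in> M" for x y
  proof -
    have "h x - d x y \<le> h y"
      unfolding h_def[of y]
    proof (rule cINF_greatest[OF S(1)])
      fix s assume s: "s \<in> S"
      have "h x \<le> d x s"
        unfolding h_def by (rule cINF_lower[OF bdd s])
      also have "\<dots> \<le> d x y + d y s"
        using that s S(2) by (intro triangle) auto
      finally show "h x - d x y \<le> d y s"
        by simp
    qed
    then show ?thesis by simp
  qed
  have cont: "continuous_map mtopology euclideanreal h"
    unfolding continuous_map_from_metric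
  proof (intro conjI ballI allI impI)
    fix a U assume a: "a \<in> M" and U: "openin euclideanreal U \<and> h a \<in> U"
    then obtain e where e: "0 < e" "ball (h a) e \<subseteq> U"
      using openE by auto
    have "h x \<in> U" if "x \<in> M" "d a x < e" for x
    proof -
      have "dist (h a) (h x) < e"
        using lip[OF a that(1)] lip[OF that(1) a] that(2) commute[of a x]
        by (simp add: dist_real_def)
      with e show ?thesis by auto
    qed
    with e(1) show "\<exists>r>0. \<forall>x. x \<in> M \<and> d a x < r \<longrightarrow> h x \<in> U"
      by blast
  qed auto
  have "x \<in> V \<longleftrightarrow> 0 < h x" if x: "x \<in> M" for x
  proof
    assume "x \<in> V"
    then obtain r where r: "0 < r" "mball x r \<subseteq> V"
      using V openin_mtopology by blast
    have "r \<le> h x"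
      unfolding h_def
    proof (rule cINF_greatest[OF S(1)])
      fix s assume "s \<in> S"
      then show "r \<le> d x s"
        using r(2) x by (force simp: S_def)
    qed
    with r(1) show "0 < h x" by simp
  next
    assume "0 < h x"
    moreover have "h x \<le> d x x" if "x \<in> S"
      unfolding h_def by (rule cINF_lower[OF bdd that])
    ultimately show "x \<in> V"
      using x by (auto simp: S_def)
  qed
  then have "V = {x \<in> topspace mtopology. 0 < h x}"
    using VM by auto
  then show ?thesis
    using functionally_open_gr[OF cont] by metis
qed

lemma functionally_open_metrizable:
  "metrizable_space Y \<Longrightarrow> openin Y V \<Longrightarrow> functionally_open Y V"
  unfolding metrizable_space_def using Metric_space.functionally_open_mtopology by metis

lemma B1_subset_K1:
  fixes X :: "'a topology" and Y :: "'b topology"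
  assumes "metrizable_space Y"
  shows "B1 X Y \<subseteq> K1 X Y"
proof
  fix f assume f: "f \<in> B1 X Y"
  then obtain g :: "nat \<Rightarrow> 'a \<Rightarrow> 'b" where
    fX: "f \<in> topspace X \<rightarrow> topspace Y" and g: "\<And>n. continuous_map X Y (g n)"
    and lim: "\<And>x. x \<in> topspace X \<Longrightarrow> limitin Y (\<lambda>n. g n x) (f x) sequentially"
    unfolding B1_def by blast
  have "functionally_Fsigma X {x \<in> topspace X. f x \<in> V}" if V: "openin Y V" for V
  proof -
    obtain h where h: "continuous_map Y euclideanreal h" "V = {y \<in> topspace Y. 0 < h y}"
      using functionally_openE[OF functionally_open_metrizable[OF assms V]] by metis
    have hlim: "(\<lambda>n. h (g n x)) \<longlonglongrightarrow> h (f x)" if "x \<in> topspace X" for x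
      using continuous_map_limit[OF h(1) lim[OF that]] by (simp add: o_def)
    \<comment> \<open>The levels 1 / (m + 1) give the exhaustion of \<open>V\<close>. A positive
      lower bound along the sequence survives the limit, whereas mere positivity of h (g n x) would
      not.\<close>
    define A where "A m n = {x \<in> topspace X. 1 / real (Suc m) \<le> (h \<circ> g n) x}" for m n
    have "{x \<in> topspace X. f x \<in> V} = (\<Union>m k. \<Inter>n\<in>{k..}. A m n)"
    proof (intro set_eqI iffI)
      fix x assume "x \<in> {x \<in> topspace X. f x \<in> V}"
      then have x: "x \<in> topspace X" "0 < h (f x)"
        by (auto simp: h(2))
      obtain m where "1 / real (Suc m) < h (f x)"
        using nat_approx_posE[OF x(2)] by blast
      then have "\<forall>\<^sub>F n in sequentially. 1 / real (Suc m) < h (g n x)"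
        by (rule order_tendstoD(1)[OF hlim[OF x(1)]])
      then obtain k where "\<And>n. k \<le> n \<Longrightarrow> 1 / real (Suc m) < h (g n x)"
        by (auto simp: eventually_sequentially)
      then have "x \<in> (\<Inter>n\<in>{k..}. A m n)"
        using x(1) by (auto simp: A_def intro: less_imp_le)
      then show "x \<in> (\<Union>m k. \<Inter>n\<in>{k..}. A m n)"
        by blast
    next
      fix x assume "x \<in> (\<Union>m k. \<Inter>n\<in>{k..}. A m n)"
      then obtain m k where mk: "\<And>n. k \<le> n \<Longrightarrow> x \<in> A m n"
        by auto
      then have x: "x \<in> topspace X"
        by (auto simp: A_def)
      have "1 / real (Suc m) \<le> h (f x)"
        by (rule tendsto_lowerbound[OF hlim[OF x]])
          (use mk in \<open>auto simp: A_def eventually_sequentially intro!: exI[of _ k]\<close>)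
      moreover have "0 < 1 / real (Suc m)"
        by simp
      ultimately have "0 < h (f x)"
        by linarith
      with x fX show "x \<in> {x \<in> topspace X. f x \<in> V}"
        by (auto simp: h(2))
    qed
    moreover have "functionally_closed X (A m n)" for m n
      unfolding A_def by (intro functionally_closed_ge continuous_map_compose[OF g h(1)])
    ultimately show ?thesis
      by (simp only:) (intro functionally_Fsigma_UN functionally_closed_imp_Fsigma
          functionally_closed_INT_atLeast)
  qed
  with fX show "f \<in> K1 X Y"
    by (simp add: K1_def)
qed

section \<open>Sigma-sfd bases for pointwise limits\<close>

text \<open>As in M. E. Rudin's proof of Stone's theorem: \<open>E n s\<close> consists of the points that lie deep
  inside the ball about \<open>s\<close> and in no ball about an earlier centre of a well-ordering, and this
  separates the sets belonging to distinct centres.\<close>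
lemma (in Metric_space) uniformly_separated_refinement:
  assumes "0 < \<epsilon>"
  obtains E :: "nat \<Rightarrow> 'a \<Rightarrow> 'a set" where
    "\<And>n s c. c \<in> E n s \<Longrightarrow> c \<in> M \<and> s \<in> M \<and> mball c (3 / real (Suc n)) \<subseteq> mball s \<epsilon>"
    "\<And>n s t c c'. c \<in> E n s \<Longrightarrow> c' \<in> E n t \<Longrightarrow> d c c' < 3 / real (Suc n) \<Longrightarrow> s = t"
    "\<And>y. y \<in> M \<Longrightarrow> \<exists>n s. y \<in> E n s"
proof -
  obtain r :: "('a \<times> 'a) set" where "Well_order r \<and> Field r = UNIV"
    using well_ordering by (rule exE)
  then have r: "Well_order r" "Field r = UNIV"
    by blast+
  have wf: "wf (r - Id)"
    using r(1) unfolding well_order_on_def by blast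
  have tot: "(s, t) \<in> r - Id \<or> (t, s) \<in> r - Id" if "s \<noteq> t" for s t
    using r that by (auto simp: well_order_on_def linear_order_on_def total_on_def)
  \<comment> \<open>With \<delta> = 1 / (n + 1), the gap 3 * \<delta> leaves room for two
    neighbourhoods of radius \<delta> and for a test neighbourhood of radius \<delta> / 2 that might
    meet both.\<close>
  define E where "E n s = {c \<in> M. s \<in> M \<and> mball c (3 / real (Suc n)) \<subseteq> mball s \<epsilon> \<and>
      (\<forall>t. (t, s) \<in> r - Id \<longrightarrow> c \<notin> mball t \<epsilon>)}" for n s
  have sep: "3 / real (Suc n) \<le> d c c'" if "c \<in> E n s" "c' \<in> E n t" "(s, t) \<in> r - Id" for n s t c c'
  proof (rule ccontr)
    assume "\<not> 3 / real (Suc n) \<le> d c c'"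
    then have "c' \<in> mball c (3 / real (Suc n))"
      using that by (auto simp: E_def)
    moreover have "mball c (3 / real (Suc n)) \<subseteq> mball s \<epsilon>" "c' \<notin> mball s \<epsilon>"
      using that by (simp_all add: E_def)
    ultimately show False
      by blast
  qed
  show thesis
  proof (rule that[of E])
    show "c \<in> M \<and> s \<in> M \<and> mball c (3 / real (Suc n)) \<subseteq> mball s \<epsilon>" if "c \<in> E n s" for n s c
      using that by (simp add: E_def)
    show "s = t" if "c \<in> E n s" "c' \<in> E n t" "d c c' < 3 / real (Suc n)" for n s t c c'
      using sep[OF that(1,2)] sep[OF that(2,1)] that(3) tot[of s t] commute[of c c'] by fastforce
    show "\<exists>n s. y \<in> E n s" if y: "y \<in> M" for y
    proof -
      have "y \<in> {s. y \<in> mball s \<epsilon>}"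
        using y assms by simp
      then obtain s where s: "y \<in> mball s \<epsilon>" "\<And>t. (t, s) \<in> r - Id \<Longrightarrow> y \<notin> mball t \<epsilon>"
        using wf unfolding wf_eq_minimal by (metis (no_types, lifting) mem_Collect_eq)
      obtain \<rho> where \<rho>: "0 < \<rho>" "mball y \<rho> \<subseteq> mball s \<epsilon>"
        using s(1) openin_mball openin_mtopology by metis
      obtain n where "1 / real (Suc n) < \<rho> / 3"
        using nat_approx_posE[of "\<rho> / 3"] \<rho>(1) by auto
      then have "mball y (3 / real (Suc n)) \<subseteq> mball y \<rho>"
        by (intro mball_subset_concentric) (simp add: field_simps)
      then have "y \<in> E n s"
        using s \<rho>(2) y by (auto simp: E_def)
      then show ?thesis by blast
    qed
  qed
qed

text \<open>An indexed family may repeat a set, for instance the empty one, under different indices.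
  Keeping one index for each set retains a single neighbourhood per set, as the unindexed notion
  requires.\<close>

lemma sfd_family_image:
  assumes "sfd_family X A I"
  shows "sfd X (A ` I)"
proof -
  obtain U where disc: "discrete_family X U I"
    and U: "\<And>i. i \<in> I \<Longrightarrow> functionally_open X (U i) \<and> X closure_of A i \<subseteq> U i"
    using assms unfolding sfd_family_def by blast
  define c where "c = inv_into I A"
  have c: "c B \<in> I" "A (c B) = B" if "B \<in> A ` I" for B
    using that by (simp_all add: c_def inv_into_into f_inv_into_f)
  have "discrete_family X (\<lambda>B. U (c B)) (A ` I)"
    unfolding discrete_family_def
  proof
    fix x assume "x \<in> topspace X"
    then obtain W where W: "openin X W" "x \<in> W"
      "\<And>i j. i \<in> I \<Longrightarrow> j \<in> I \<Longrightarrow> W \<inter> U i \<noteq> {} \<Longrightarrow> W \<inter> U j \<noteq> {} \<Longrightarrow> i = j"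
      using discrete_familyE[OF disc] by metis
    have "B = B'" if "B \<in> A ` I" "B' \<in> A ` I" "W \<inter> U (c B) \<noteq> {}" "W \<inter> U (c B') \<noteq> {}" for B B'
    proof -
      have "c B = c B'"
        using W(3)[OF c(1)[OF that(1)] c(1)[OF that(2)] that(3,4)] .
      then show ?thesis
        using c(2)[OF that(1)] c(2)[OF that(2)] by metis
    qed
    with W(1,2) show "\<exists>W. openin X W \<and> x \<in> W \<and> (\<forall>B\<in>A ` I. \<forall>B'\<in>A ` I.
        W \<inter> U (c B) \<noteq> {} \<and> W \<inter> U (c B') \<noteq> {} \<longrightarrow> B = B')"
      by (intro exI[of _ W]) simp
  qed
  moreover have "functionally_open X (U (c B)) \<and> X closure_of B \<subseteq> U (c B)" if "B \<in> A ` I" for B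
    using U[OF c(1)[OF that]] c(2)[OF that] by simp
  ultimately show ?thesis
    unfolding sfd_def sfd_family_def
    by (intro exI[of _ "\<lambda>B. U (c B)"] conjI ballI) (assumption, blast+)
qed

text \<open>Passing to the closure costs another \<delta> / 2, so radius \<delta> suffices for the
  surrounding sets. If the preimage of the ball of radius \<delta> / 2 about \<open>g x\<close>
  meets two of these, both centre sets come within 3/2 * \<delta> of \<open>g x\<close>, hence
  within 3 * \<delta> of each other, and the indices agree.\<close>

lemma (in Metric_space) sfd_preimage_separated:
  assumes g: "continuous_map X mtopology g"
    and sep: "\<And>s t c c'. c \<in> E s \<Longrightarrow> c' \<in> E t \<Longrightarrow> d c c' < 3 * \<delta> \<Longrightarrow> s = t"
    and EM: "\<And>s. E s \<subseteq> M" and "0 < \<delta>"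
    and A: "\<And>s. A s \<subseteq> {x \<in> topspace X. g x \<in> (\<Union>c\<in>E s. mball c (\<delta> / 2))}"
  shows "sfd X (range A)"
proof -
  have gM: "g x \<in> M" if "x \<in> topspace X" for x
    using continuous_map_funspace[OF g] that by auto
  define U where "U s = {x \<in> topspace X. g x \<in> (\<Union>c\<in>E s. mball c \<delta>)}" for s
  have nbhd: "openin X {y \<in> topspace X. g y \<in> mball (g x) (\<delta> / 2)}" for x
    using openin_continuous_map_preimage[OF g openin_mball] .
  have "functionally_open X (U s)" for s
    unfolding U_def
    by (intro functionally_open_preimage[OF g] functionally_open_mtopology openin_Union) auto
  moreover have "X closure_of A s \<subseteq> U s" for s
  proof
    fix x assume x: "x \<in> X closure_of A s"
    then have xX: "x \<in> topspace X"
      by (simp add: in_closure_of)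
    have "x \<in> {y \<in> topspace X. g y \<in> mball (g x) (\<delta> / 2)}"
      using xX gM \<open>0 < \<delta>\<close> by simp
    then obtain y where y: "y \<in> A s" "y \<in> topspace X" "d (g x) (g y) < \<delta> / 2"
      using x nbhd[of x] unfolding in_closure_of by (metis (no_types, lifting) in_mball mem_Collect_eq)
    then obtain c where c: "c \<in> E s" "d c (g y) < \<delta> / 2"
      using A[of s] by auto
    have "d c (g x) \<le> d c (g y) + d (g x) (g y)"
      using triangle'[of c "g y" "g x"] c EM gM y xX by blast
    then have "d c (g x) < \<delta>"
      using c y by linarith
    then show "x \<in> U s"
      using c EM gM xX by (auto simp: U_def)
  qed
  moreover have "discrete_family X U UNIV"
    unfolding discrete_family_def
  proof
    fix x assume xX: "x \<in> topspace X"
    define W where "W = {y \<in> topspace X. g y \<in> mball (g x) (\<delta> / 2)}"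
    have near: "\<exists>c\<in>E s. d c (g x) < 3 / 2 * \<delta>" if ne: "W \<inter> U s \<noteq> {}" for s
    proof -
      obtain y where "y \<in> W" "y \<in> U s"
        using ne by blast
      then have y: "y \<in> topspace X" "d (g x) (g y) < \<delta> / 2" "g y \<in> (\<Union>c\<in>E s. mball c \<delta>)"
        by (simp_all add: W_def U_def)
      then obtain c where c: "c \<in> E s" "d c (g y) < \<delta>"
        by auto
      have "d c (g x) \<le> d c (g y) + d (g x) (g y)"
        using triangle'[of c "g y" "g x"] c EM gM y xX by blast
      with c y show ?thesis
        by (intro bexI[of _ c]) auto
    qed
    have "s = t" if ne: "W \<inter> U s \<noteq> {}" "W \<inter> U t \<noteq> {}" for s t
    proof -
      obtain c c' where c: "c \<in> E s" "d c (g x) < 3 / 2 * \<delta>" "c' \<in> E t" "d c' (g x) < 3 / 2 * \<delta>"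
        using near[OF ne(1)] near[OF ne(2)] by blast
      have "d c c' \<le> d c (g x) + d c' (g x)"
        using triangle'[of c "g x" c'] c EM gM xX by blast
      with c have "d c c' < 3 * \<delta>"
        by linarith
      with sep c show ?thesis by blast
    qed
    moreover have "openin X W" "x \<in> W"
      using nbhd[of x] xX gM \<open>0 < \<delta>\<close> by (simp_all add: W_def)
    ultimately show "\<exists>W. openin X W \<and> x \<in> W \<and> (\<forall>i\<in>UNIV. \<forall>j\<in>UNIV.
        W \<inter> U i \<noteq> {} \<and> W \<inter> U j \<noteq> {} \<longrightarrow> i = j)"
      by (intro exI[of _ W]) simp
  qed
  ultimately have "sfd_family X A UNIV"
    unfolding sfd_family_def by (intro exI[of _ U]) simp
  then show ?thesis
    by (rule sfd_family_image)
qed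

lemma (in Metric_space) pointwise_limit_sigma_sfd_base:
  fixes g :: "nat \<Rightarrow> 'b \<Rightarrow> 'a"
  assumes g: "\<And>n. continuous_map X mtopology (g n)"
    and lim: "\<And>x. x \<in> topspace X \<Longrightarrow> limitin mtopology (\<lambda>n. g n x) (f x) sequentially"
  shows "\<exists>\<B>. sigma_sfd X \<B> \<and> base_for X mtopology f \<B>"
proof -
  have "\<exists>E :: nat \<Rightarrow> 'a \<Rightarrow> 'a set.
    (\<forall>n s c. c \<in> E n s \<longrightarrow> c \<in> M \<and> s \<in> M \<and> mball c (3 / real (Suc n)) \<subseteq> mball s (1 / real (Suc m))) \<and>
    (\<forall>n s t c c'. c \<in> E n s \<longrightarrow> c' \<in> E n t \<longrightarrow> d c c' < 3 / real (Suc n) \<longrightarrow> s = t) \<and>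
    (\<forall>y \<in> M. \<exists>n s. y \<in> E n s)" for m
  proof -
    have "0 < 1 / real (Suc m)"
      by simp
    then obtain E :: "nat \<Rightarrow> 'a \<Rightarrow> 'a set" where E:
      "\<And>n s c. c \<in> E n s \<Longrightarrow> c \<in> M \<and> s \<in> M \<and> mball c (3 / real (Suc n)) \<subseteq> mball s (1 / real (Suc m))"
      "\<And>n s t c c'. c \<in> E n s \<Longrightarrow> c' \<in> E n t \<Longrightarrow> d c c' < 3 / real (Suc n) \<Longrightarrow> s = t"
      "\<And>y. y \<in> M \<Longrightarrow> \<exists>n s. y \<in> E n s"
      by (rule uniformly_separated_refinement) (rule that)
    show ?thesis
      by (intro exI[of _ E] conjI allI impI ballI; use E in meson)
  qed
  then have "\<forall>m. \<exists>E :: nat \<Rightarrow> 'a \<Rightarrow> 'a set.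
    (\<forall>n s c. c \<in> E n s \<longrightarrow> c \<in> M \<and> s \<in> M \<and> mball c (3 / real (Suc n)) \<subseteq> mball s (1 / real (Suc m))) \<and>
    (\<forall>n s t c c'. c \<in> E n s \<longrightarrow> c' \<in> E n t \<longrightarrow> d c c' < 3 / real (Suc n) \<longrightarrow> s = t) \<and>
    (\<forall>y \<in> M. \<exists>n s. y \<in> E n s)"
    by (rule allI)
  from choice[OF this] obtain E where E0: "\<forall>m.
    (\<forall>n s c. c \<in> E m n s \<longrightarrow> c \<in> M \<and> s \<in> M \<and> mball c (3 / real (Suc n)) \<subseteq> mball s (1 / real (Suc m))) \<and>
    (\<forall>n s t c c'. c \<in> E m n s \<longrightarrow> c' \<in> E m n t \<longrightarrow> d c c' < 3 / real (Suc n) \<longrightarrow> s = t) \<and>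
    (\<forall>y \<in> M. \<exists>n s. y \<in> E m n s)"
    by (rule exE)
  have E1: "c \<in> M" "s \<in> M" "mball c (3 / real (Suc n)) \<subseteq> mball s (1 / real (Suc m))"
    if "c \<in> E m n s" for m n s c
    using E0 that by blast+
  have E2: "s = t" if "c \<in> E m n s" "c' \<in> E m n t" "d c c' < 3 / real (Suc n)" for m n s t c c'
    using E0 that by blast
  have E3: "\<exists>n s. y \<in> E m n s" if "y \<in> M" for y m
    using E0 that by blast
  \<comment> \<open>The single index \<open>l = k\<close> already makes the family sfd, as only one
    continuous map is involved; the requirement for all later \<open>l\<close> is what transfers the
    location to the limit \<open>f\<close>.\<close>
  define A where "A m n k s = {x \<in> topspace X. \<forall>l\<ge>k. g l x \<in> (\<Union>c\<in>E m n s. mball c (1 / real (Suc n) / 2))}"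
    for m n k s
  define \<F> where "\<F> i = (case prod_decode i of (m, p) \<Rightarrow> case prod_decode p of (n, k) \<Rightarrow> range (A m n k))" for i
  have "sfd X (range (A m n k))" for m n k
  proof (rule sfd_preimage_separated[OF g[of k], where E="E m n" and \<delta>="1 / real (Suc n)"])
    show "s = t" if "c \<in> E m n s" "c' \<in> E m n t" "d c c' < 3 * (1 / real (Suc n))" for s t c c'
      using E2 that by simp
    show "A m n k s \<subseteq> {x \<in> topspace X. g k x \<in> (\<Union>c\<in>E m n s. mball c (1 / real (Suc n) / 2))}" for s
      unfolding A_def by blast
  qed (use E1 in auto)
  then have "sfd X (\<F> i)" for i
    by (simp add: \<F>_def split: prod.splits)
  then have "sigma_sfd X (\<Union>i. \<F> i)"
    unfolding sigma_sfd_def by blast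
  moreover have "base_for X mtopology f (\<Union>i. \<F> i)"
    unfolding base_for_def
  proof (intro allI impI)
    fix V assume V: "openin mtopology V"
    have member: "A m n k s \<in> (\<Union>i. \<F> i)" for m n k s
      by (rule UN_I[of "prod_encode (m, prod_encode (n, k))"]) (auto simp: \<F>_def)
    have "\<exists>B\<in>(\<Union>i. \<F> i). x \<in> B \<and> B \<subseteq> {x \<in> topspace X. f x \<in> V}"
      if x: "x \<in> topspace X" "f x \<in> V" for x
    proof -
      obtain r where r: "0 < r" "mball (f x) r \<subseteq> V"
        using V x(2) openin_mtopology by blast
      have fM: "f y \<in> M" if "y \<in> topspace X" for y
        using lim[OF that] by (simp add: limitin_metric)
      \<comment> \<open>Both \<open>f x\<close> and the late values \<open>g l y\<close> will lie in
        one ball of radius 1 / (m + 1), so they are less than 2 / (m + 1) < r apart; the rest of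
        \<open>r\<close> is left for the distance from \<open>g l y\<close> to
        \<open>f y\<close>.\<close>
      obtain m where m: "1 / real (Suc m) < r / 2"
        using nat_approx_posE[of "r / 2"] r(1) by auto
      obtain n s where ns: "f x \<in> E m n s"
        using E3[OF fM[OF x(1)]] by blast
      have pos: "0 < 1 / real (Suc n) / 2"
        by simp
      obtain k where k: "\<And>l. k \<le> l \<Longrightarrow> g l x \<in> M \<and> d (g l x) (f x) < 1 / real (Suc n) / 2"
        using lim[OF x(1)] pos unfolding limit_metric_sequentially by blast
      have "x \<in> A m n k s"
        unfolding A_def
      proof (intro CollectI conjI allI impI)
        fix l assume "k \<le> l"
        then have "g l x \<in> mball (f x) (1 / real (Suc n) / 2)"
          using k[of l] fM[OF x(1)] commute[of "g l x" "f x"] by auto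
        with ns show "g l x \<in> (\<Union>c\<in>E m n s. mball c (1 / real (Suc n) / 2))"
          by blast
      qed (rule x)
      moreover have "f y \<in> V" if y: "y \<in> A m n k s" for y
      proof -
        have yX: "y \<in> topspace X"
          using y by (simp add: A_def)
        have close: "g l y \<in> mball s (1 / real (Suc m))" if l: "k \<le> l" for l
        proof -
          obtain c where c: "c \<in> E m n s" "g l y \<in> mball c (1 / real (Suc n) / 2)"
            using y l unfolding A_def by blast
          have "mball c (1 / real (Suc n) / 2) \<subseteq> mball c (3 / real (Suc n))"
            by (intro mball_subset_concentric) (simp add: field_simps)
          then show ?thesis
            using E1(3)[OF c(1)] c(2) by blast
        qed
        have fx: "f x \<in> mball s (1 / real (Suc m))"
        proof (rule subsetD[OF E1(3)[OF ns]])
          show "f x \<in> mball (f x) (3 / real (Suc n))"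
            using E1(1)[OF ns] by simp
        qed
        have "0 < r - 2 / real (Suc m)"
          using m by (simp add: field_simps)
        then obtain l where l: "k \<le> l" "g l y \<in> M" "d (g l y) (f y) < r - 2 / real (Suc m)"
          using lim[OF yX] unfolding limit_metric_sequentially by (meson nat_le_linear)
        have s: "s \<in> M"
          using E1(2)[OF ns] .
        have "d (f x) (f y) \<le> d (f x) (g l y) + d (g l y) (f y)"
          using fM x yX l by (intro triangle) auto
        also have "d (f x) (g l y) \<le> d s (f x) + d s (g l y)"
          using fM[OF x(1)] l(2) s by (intro triangle'')
        finally have "d (f x) (f y) < r"
          using fx close[OF l(1)] l(3) by simp
        then show ?thesis
          using r(2) fM x yX by auto
      qed
      ultimately show ?thesis
        using member[of m n k s] by (intro bexI[of _ "A m n k s"]) (auto simp: A_def)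
    qed
    then have "{x \<in> topspace X. f x \<in> V} = \<Union>{B \<in> (\<Union>i. \<F> i). B \<subseteq> {x \<in> topspace X. f x \<in> V}}"
      by blast
    then show "\<exists>\<C>\<subseteq>\<Union>i. \<F> i. {x \<in> topspace X. f x \<in> V} = \<Union>\<C>"
      by (intro exI[of _ "{B \<in> (\<Union>i. \<F> i). B \<subseteq> {x \<in> topspace X. f x \<in> V}}"] conjI) auto
  qed
  ultimately show ?thesis by blast
qed

lemma B1_subset_Sigma_f:
  fixes X :: "'a topology" and Y :: "'b topology"
  assumes "metrizable_space Y"
  shows "B1 X Y \<subseteq> Sigma_f X Y"
proof
  fix f assume "f \<in> B1 X Y"
  then obtain g :: "nat \<Rightarrow> 'a \<Rightarrow> 'b" where
    fX: "f \<in> topspace X \<rightarrow> topspace Y" and g: "\<And>n. continuous_map X Y (g n)"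
    and lim: "\<And>x. x \<in> topspace X \<Longrightarrow> limitin Y (\<lambda>n. g n x) (f x) sequentially"
    unfolding B1_def by blast
  obtain M d where "Metric_space M d" and Y: "Y = Metric_space.mtopology M d"
    using assms unfolding metrizable_space_def by blast
  then interpret Metric_space M d by simp
  have "\<exists>\<B>. sigma_sfd X \<B> \<and> base_for X Y f \<B>"
    using pointwise_limit_sigma_sfd_base g lim unfolding Y by blast
  with fX show "f \<in> Sigma_f X Y"
    by (simp add: Sigma_f_def)
qed

section \<open>Correcting continuous maps along short paths\<close>

text \<open>Continuity on \<open>U\<close> into the discrete topology: every subset of the range has
  an open preimage. The trivial predicate makes \<open>U\<close> itself open, and negating a
  predicate shows that the preimages are clopen in \<open>U\<close>.\<close>

definition locally_constant_on :: "'a topology \<Rightarrow> 'a set \<Rightarrow> ('a \<Rightarrow> 'b) \<Rightarrow> bool" where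
  "locally_constant_on X U z \<longleftrightarrow> (\<forall>P. openin X {x \<in> U. P (z x)})"

lemma locally_constant_onD: "locally_constant_on X U z \<Longrightarrow> openin X {x \<in> U. P (z x)}"
  by (simp add: locally_constant_on_def)

text \<open>\<open>Q\<close> is an arbitrary relation, in the application path closeness of two
  values: splitting along the fibres of \<open>z\<close> leaves conditions on \<open>w\<close>
  alone.\<close>

lemma locally_constant_on_pair:
  assumes "locally_constant_on X U z" "locally_constant_on X W w"
  shows "openin X {x \<in> U \<inter> W. Q (z x) (w x)}"
proof -
  have "{x \<in> U \<inter> W. Q (z x) (w x)} = (\<Union>a. {x \<in> U. z x = a} \<inter> {x \<in> W. Q a (w x)})"
    by auto
  moreover have "openin X ({x \<in> U. z x = a} \<inter> {x \<in> W. Q a (w x)})" for a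
    by (intro openin_Int locally_constant_onD[OF assms(1), where P="\<lambda>b. b = a"]
        locally_constant_onD[OF assms(2)])
  ultimately show ?thesis
    by auto
qed

lemma locally_constant_on_subset:
  assumes "locally_constant_on X U z" "openin X W" "W \<subseteq> U" "\<And>x. x \<in> W \<Longrightarrow> w x = z x"
  shows "locally_constant_on X W w"
  unfolding locally_constant_on_def
proof
  fix P
  have "{x \<in> W. P (w x)} = W \<inter> {x \<in> U. P (z x)}"
    using assms(3,4) by auto
  then show "openin X {x \<in> W. P (w x)}"
    using openin_Int[OF assms(2) locally_constant_onD[OF assms(1)]] by metis
qed

section \<open>Points joined inside small path connected sets, and the correction step\<close>

context Metric_space
begin

text \<open>A connecting set, rather than a path, makes symmetry immediate and transitivity a union.
  The bound on the diameter is not strict, so that a path connected space of diameter at most 1 is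
  itself a witness for \<open>e = 1\<close>.\<close>

definition path_close :: "real \<Rightarrow> 'a \<Rightarrow> 'a \<Rightarrow> bool" where
  "path_close e a b \<longleftrightarrow>
     (\<exists>S. path_connectedin mtopology S \<and> a \<in> S \<and> b \<in> S \<and> (\<forall>x\<in>S. \<forall>y\<in>S. d x y \<le> e))"

lemma path_close_sym: "path_close e a b \<Longrightarrow> path_close e b a"
  unfolding path_close_def by blast

lemma path_close_dist: "path_close e a b \<Longrightarrow> d a b \<le> e"
  unfolding path_close_def by blast

lemma path_close_trans:
  assumes "path_close e a b" "path_close e' b c"
  shows "path_close (e + e') a c"
proof -
  obtain S where S: "path_connectedin mtopology S" "a \<in> S" "b \<in> S" "\<And>x y. x \<in> S \<Longrightarrow> y \<in> S \<Longrightarrow> d x y \<le> e"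
    using assms(1) unfolding path_close_def by blast
  obtain T where T: "path_connectedin mtopology T" "b \<in> T" "c \<in> T" "\<And>x y. x \<in> T \<Longrightarrow> y \<in> T \<Longrightarrow> d x y \<le> e'"
    using assms(2) unfolding path_close_def by blast
  have ST: "S \<subseteq> M" "T \<subseteq> M"
    using S(1) T(1) path_connectedin_subset_topspace by fastforce+
  have e: "0 \<le> e" "0 \<le> e'"
    using S(4)[OF S(3,3)] T(4)[OF T(2,2)] nonneg[of b b] by linarith+
  have cross: "d x y \<le> e + e'" if "x \<in> S" "y \<in> T" for x y
  proof -
    have "d x y \<le> d x b + d b y"
      using that ST S(3) by (intro triangle) auto
    with S(4)[OF that(1) S(3)] T(4)[OF T(2) that(2)] show ?thesis
      by linarith
  qed
  have "d x y \<le> e + e'" if "x \<in> S \<union> T" "y \<in> S \<union> T" for x y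
    using that S(4)[of x y] T(4)[of x y] cross[of x y] cross[of y x] commute[of x y] e by fastforce
  moreover have "path_connectedin mtopology (S \<union> T)"
    using S T by (intro path_connectedin_Un) auto
  ultimately show ?thesis
    unfolding path_close_def using S(2) T(3) by (intro exI[of _ "S \<union> T"]) simp
qed

lemma path_close_path:
  assumes "path_close e a b"
  obtains p where "pathin mtopology p" "p 0 = a" "p 1 = b" "\<And>t. t \<in> {0..1} \<Longrightarrow> d a (p t) \<le> e"
proof -
  obtain S where S: "path_connectedin mtopology S" "a \<in> S" "b \<in> S" "\<And>x y. x \<in> S \<Longrightarrow> y \<in> S \<Longrightarrow> d x y \<le> e"
    using assms unfolding path_close_def by blast
  then obtain p where p: "pathin mtopology p" "p \<in> {0..1} \<rightarrow> S" "p 0 = a" "p 1 = b"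
    unfolding path_connectedin by blast
  show thesis
    using p S(2) by (intro that[OF p(1,3,4)] S(4)) auto
qed

text \<open>The path connected set sits between the open set \<open>N\<close> and the ball of radius
  e / 2. It serves all pairs from \<open>N\<close>, although \<open>N\<close> itself need not be
  path connected.\<close>

lemma path_close_neighbourhood:
  assumes "locally_path_connected_space mtopology" "y \<in> M" "0 < e"
  obtains N where "openin mtopology N" "y \<in> N" "\<And>a b. a \<in> N \<Longrightarrow> b \<in> N \<Longrightarrow> path_close e a b"
proof -
  have "y \<in> mball y (e / 2)"
    using assms(2,3) by simp
  then obtain N S where N: "openin mtopology N" "path_connectedin mtopology S" "y \<in> N" "N \<subseteq> S"
    "S \<subseteq> mball y (e / 2)"
    using assms(1) openin_mball[of y "e / 2"]
    unfolding locally_path_connected_space_def neighbourhood_base_of by meson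
  have "d a b \<le> e" if "a \<in> S" "b \<in> S" for a b
  proof -
    have ab: "a \<in> mball y (e / 2)" "b \<in> mball y (e / 2)"
      using that N(5) by blast+
    then have "d a b \<le> d y a + d y b"
      using assms(2) by (intro triangle'') auto
    with ab show ?thesis by simp
  qed
  then show thesis
    using N by (intro that[of N]) (auto simp: path_close_def)
qed

text \<open>Where \<open>g\<close> and \<open>z\<close> are both locally constant, \<open>g'\<close> runs along a short path from the value of
  \<open>g\<close> to that of \<open>z\<close>; the time parameter is \<open>0\<close> near the boundary of this region and \<open>1\<close> near \<open>D\<close>.\<close>
lemma adjust_along_paths:
  assumes g: "continuous_map X mtopology g"
    and W: "functionally_open X W" "locally_constant_on X W g"
    and U: "functionally_open X U" "locally_constant_on X U z"
    and D: "functionally_closed X D" "D \<subseteq> W" "D \<subseteq> U"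
    and e: "0 \<le> e" "0 \<le> e'"
    and gf: "\<And>x. x \<in> D \<Longrightarrow> path_close e (g x) (f x)"
    and zf: "\<And>x. x \<in> D \<Longrightarrow> path_close e' (z x) (f x)"
  obtains g' W' where "continuous_map X mtopology g'" "functionally_open X W'" "D \<subseteq> W'"
    "locally_constant_on X W' g'" "\<And>x. x \<in> D \<Longrightarrow> g' x = z x"
    "\<And>x. x \<in> topspace X \<Longrightarrow> d (g x) (g' x) \<le> e + e'"
proof -
  \<comment> \<open>Both maps are locally constant on \<open>W \<inter> U\<close>, so this region is
    clopen there and therefore functionally open. It contains \<open>D\<close> because the two
    values are joined through \<open>f x\<close>.\<close>
  define V where "V = {x \<in> W \<inter> U. path_close (e + e') (g x) (z x)}"
  have V: "openin X V"
    unfolding V_def by (rule locally_constant_on_pair[OF W(2) U(2)])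
  have "W \<inter> U - V = {x \<in> W \<inter> U. \<not> path_close (e + e') (g x) (z x)}"
    by (auto simp: V_def)
  then have "openin X (W \<inter> U - V)"
    using locally_constant_on_pair[OF W(2) U(2), of "\<lambda>a b. \<not> path_close (e + e') a b"] by simp
  then have fV: "functionally_open X V"
    using V by (intro functionally_open_clopen_part[OF functionally_open_Int[OF W(1) U(1)]])
      (auto simp: V_def)
  have "D \<subseteq> V"
    using D path_close_trans[OF gf path_close_sym[OF zf]] by (auto simp: V_def)
  obtain \<phi> where \<phi>: "continuous_map X euclideanreal \<phi>" "D = {x \<in> topspace X. \<phi> x = 1}"
    "V = {x \<in> topspace X. 0 < \<phi> x}"
    using functional_separation[OF D(1) fV \<open>D \<subseteq> V\<close>] by metis
  \<comment> \<open>The time is 0 where \<phi> is at most 1/3 and 1 where it is at least 2/3. Thus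
    \<open>g'\<close> equals \<open>g\<close> on an open set covering the complement of
    \<open>V\<close>, and equals \<open>z\<close> on an open set containing
    \<open>D\<close>.\<close>
  define r where "r x = max 0 (min 1 (3 * \<phi> x - 1))" for x
  have r: "continuous_map X (top_of_set {0..1}) r"
    unfolding r_def continuous_map_in_subtopology
    by (auto intro!: continuous_intros \<phi>(1))
  have r01: "r x \<in> {0..1}" for x
    by (simp add: r_def)
  \<comment> \<open>The path is chosen for the pair of values and not for the point
    \<open>x\<close>; continuity of \<open>g'\<close> rests on this.\<close>
  have "\<forall>ab. \<exists>p. path_close (e + e') (fst ab) (snd ab) \<longrightarrow> pathin mtopology p \<and> p 0 = fst ab \<and>
      p 1 = snd ab \<and> (\<forall>t\<in>{0..1}. d (fst ab) (p t) \<le> e + e')"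
    using path_close_path by (metis (no_types, lifting))
  from choice[OF this] obtain p where p0: "\<forall>ab. path_close (e + e') (fst ab) (snd ab) \<longrightarrow>
      pathin mtopology (p ab) \<and> p ab 0 = fst ab \<and>
      p ab 1 = snd ab \<and> (\<forall>t\<in>{0..1}. d (fst ab) (p ab t) \<le> e + e')"
    by (rule exE)
  have p: "pathin mtopology (p (a, b))" "p (a, b) 0 = a" "p (a, b) 1 = b"
    "\<And>t. t \<in> {0..1} \<Longrightarrow> d a (p (a, b) t) \<le> e + e'" if "path_close (e + e') a b" for a b
    using p0[rule_format, of "(a, b)"] that by simp_all
  define g' where "g' x = (if x \<in> V then p (g x, z x) (r x) else g x)" for x
  have close: "path_close (e + e') (g x) (z x)" if "x \<in> V" for x
    using that by (simp add: V_def)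
  have g'_g: "g' x = g x" if "\<phi> x < 1 / 3" for x
    using p(2)[OF close, of x] that by (auto simp: g'_def r_def)
  have g'_z: "g' x = z x" if "x \<in> topspace X" "2 / 3 < \<phi> x" for x
  proof -
    have "x \<in> V"
      using that by (simp add: \<phi>(3))
    then show ?thesis
      using p(3)[OF close[OF \<open>x \<in> V\<close>]] that by (simp add: g'_def r_def)
  qed
  define W' where "W' = {x \<in> topspace X. 2 / 3 < \<phi> x}"
  show thesis
  proof (rule that[of g' W'])
    show "continuous_map X mtopology g'"
    proof (rule continuous_map_locally_eq)
      fix x assume x: "x \<in> topspace X"
      show "\<exists>G h. openin X G \<and> x \<in> G \<and> continuous_map X mtopology h \<and> (\<forall>y\<in>G. g' y = h y)"
      proof (cases "\<phi> x < 1 / 3")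
        case True
        have "openin X {y \<in> topspace X. \<phi> y \<in> {..<1/3}}"
          by (rule openin_continuous_map_preimage[OF \<phi>(1)]) simp
        then show ?thesis
          using True x g g'_g by (intro exI[of _ "{y \<in> topspace X. \<phi> y \<in> {..<1/3}}"] exI[of _ g]) simp
      next
        case False
        then have xV: "x \<in> V"
          using x by (simp add: \<phi>(3))
        \<comment> \<open>On \<open>G\<close> both endpoints are frozen, so \<open>g'\<close> is
          there a single path composed with the continuous time \<open>r\<close>.\<close>
        define G where "G = V \<inter> {y \<in> W \<inter> U. g y = g x \<and> z y = z x}"
        have "openin X G"
          unfolding G_def by (intro openin_Int V locally_constant_on_pair[OF W(2) U(2)])
        moreover have "x \<in> G"
          using xV by (auto simp: G_def V_def)
        moreover have "continuous_map X mtopology (p (g x, z x) \<circ> r)"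
          using r p(1)[OF close[OF xV]] unfolding pathin_def by (rule continuous_map_compose)
        moreover have "\<forall>y\<in>G. g' y = (p (g x, z x) \<circ> r) y"
          by (simp add: G_def g'_def)
        ultimately show ?thesis by blast
      qed
    qed
    show "functionally_open X W'"
      unfolding W'_def by (rule functionally_open_gr[OF \<phi>(1)])
    moreover have "W' \<subseteq> V"
      by (auto simp: W'_def \<phi>(3))
    moreover have "V \<subseteq> U"
      by (auto simp: V_def)
    ultimately show "locally_constant_on X W' g'"
      by (intro locally_constant_on_subset[OF U(2)] functionally_open_imp_openin)
        (auto simp: W'_def g'_z)
    show "D \<subseteq> W'"
      by (auto simp: \<phi>(2) W'_def)
    then show "g' x = z x" if "x \<in> D" for x
      using that g'_z by (auto simp: W'_def)
    show "d (g x) (g' x) \<le> e + e'" if "x \<in> topspace X" for x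
    proof (cases "x \<in> V")
      case True
      then show ?thesis
        using p(4)[OF close[OF True] r01] by (simp add: g'_def)
    next
      case False
      then show ?thesis
        using e funcset_mem[OF continuous_map_funspace[OF g] that] by (simp add: g'_def)
    qed
  qed
qed

lemma approximate_on_nested:
  fixes D :: "nat \<Rightarrow> 'b set"
  assumes f: "f \<in> topspace X \<rightarrow> M"
    and y0: "\<And>y. y \<in> M \<Longrightarrow> path_close 1 y0 y" "y0 \<in> M"
    and D: "\<And>l. functionally_closed X (D l)"
    and U: "\<And>l. functionally_open X (U l)" "\<And>l. locally_constant_on X (U l) (z l)"
    and DU: "\<And>l. D l \<subseteq> U l"
    and zf: "\<And>l x. x \<in> D l \<Longrightarrow> path_close ((1/2) ^ Suc l) (z l x) (f x)"
  shows "\<exists>g. continuous_map X mtopology g \<and>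
    (\<forall>m\<le>N. \<forall>x\<in>topspace X \<inter> (\<Inter>l\<in>{..<m}. D l). d (g x) (f x) \<le> 5 * (1/2) ^ m)"
proof -
  \<comment> \<open>The shift in indices is deliberate: \<open>D l\<close> carries accuracy
    2^-(l+1), so \<open>C m\<close>, which uses only l < m, carries accuracy 2^-m. In particular
    \<open>C 0\<close> is the whole space, where the constant \<open>y0\<close> is accurate to
    1.\<close>
  define C where "C m = topspace X \<inter> (\<Inter>l\<in>{..<m}. D l)" for m
  have C: "functionally_closed X (C m)" for m
    unfolding C_def by (intro functionally_closed_INT_finite D) simp
  have CX: "C m \<subseteq> topspace X" for m
    by (simp add: C_def)
  have C_Suc: "C (Suc m) \<subseteq> C m" "C (Suc m) \<subseteq> D m" for m
    by (auto simp: C_def)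
  \<comment> \<open>At m = N the bound is 2^-N, which path closeness gives directly. Passing to N +
    1 moves values by at most 2^-N + 2^-(N+1), while lowering the subtracted term from 4 * 2^-N to 4
    * 2^-(N+1) allows for 2 * 2^-N. Local constancy is maintained only near \<open>C N\<close>,
    where the next correction takes place.\<close>
  have "\<exists>g W. continuous_map X mtopology g \<and> functionally_open X W \<and> C N \<subseteq> W \<and>
      locally_constant_on X W g \<and> (\<forall>x\<in>C N. path_close ((1/2) ^ N) (g x) (f x)) \<and>
      (\<forall>m\<le>N. \<forall>x\<in>C m. d (g x) (f x) \<le> 5 * (1/2) ^ m - 4 * (1/2) ^ N)"
  proof (induction N)
    case 0
    have "path_close 1 y0 (f x)" if "x \<in> topspace X" for x
      using y0(1) f that by auto
    moreover have "locally_constant_on X (topspace X) (\<lambda>_. y0)"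
      unfolding locally_constant_on_def
    proof
      show "openin X {x \<in> topspace X. P y0}" for P
        by (cases "P y0") simp_all
    qed
    ultimately show ?case
      using y0(2) path_close_dist functionally_open_topspace[of X]
      by (intro exI[of _ "\<lambda>_. y0"] exI[of _ "topspace X"]) (simp add: C_def)
  next
    case (Suc N)
    then obtain g W where g: "continuous_map X mtopology g" "functionally_open X W" "C N \<subseteq> W"
      "locally_constant_on X W g" "\<And>x. x \<in> C N \<Longrightarrow> path_close ((1/2) ^ N) (g x) (f x)"
      "\<And>m x. m \<le> N \<Longrightarrow> x \<in> C m \<Longrightarrow> d (g x) (f x) \<le> 5 * (1/2) ^ m - 4 * (1/2) ^ N"
      by blast
    have "C (Suc N) \<subseteq> W" "C (Suc N) \<subseteq> U N"
      using C_Suc[of N] g(3) DU[of N] by auto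
    moreover have "path_close ((1/2) ^ N) (g x) (f x)" "path_close ((1/2) ^ Suc N) (z N x) (f x)"
      if "x \<in> C (Suc N)" for x
      using that C_Suc[of N] g(5) zf by blast+
    ultimately obtain g' W' where g': "continuous_map X mtopology g'" "functionally_open X W'"
      "C (Suc N) \<subseteq> W'" "locally_constant_on X W' g'" "\<And>x. x \<in> C (Suc N) \<Longrightarrow> g' x = z N x"
      "\<And>x. x \<in> topspace X \<Longrightarrow> d (g x) (g' x) \<le> (1/2) ^ N + (1/2) ^ Suc N"
      using adjust_along_paths[OF g(1,2,4) U[of N] C[of "Suc N"], where e="(1/2) ^ N" and e'="(1/2) ^ Suc N" and f=f]
      by (metis zero_le_divide_1_iff zero_le_numeral zero_le_power)
    have zf': "path_close ((1/2) ^ Suc N) (g' x) (f x)" if "x \<in> C (Suc N)" for x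
      using zf[of x N] C_Suc(2) that g'(5) by auto
    have "d (g' x) (f x) \<le> 5 * (1/2) ^ m - 4 * (1/2) ^ Suc N" if m: "m \<le> Suc N" and x: "x \<in> C m" for m x
    proof (cases "m = Suc N")
      case True
      then show ?thesis
        using path_close_dist[OF zf'] x by simp
    next
      case False
      have xX: "x \<in> topspace X"
        using x CX by blast
      have "d (g' x) (f x) \<le> d (g x) (g' x) + d (g x) (f x)"
        using continuous_map_funspace[OF g(1)] continuous_map_funspace[OF g'(1)] f xX
        by (intro triangle'') auto
      also have "\<dots> \<le> ((1/2) ^ N + (1/2) ^ Suc N) + (5 * (1/2) ^ m - 4 * (1/2) ^ N)"
        using False m x by (intro add_mono g'(6)[OF xX] g(6)) auto
      also have "\<dots> \<le> 5 * (1/2) ^ m - 4 * (1/2) ^ Suc N"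
        by simp
      finally show ?thesis .
    qed
    with g' zf' show ?case by blast
  qed
  then obtain g where g: "continuous_map X mtopology g"
    "\<And>m x. m \<le> N \<Longrightarrow> x \<in> C m \<Longrightarrow> d (g x) (f x) \<le> 5 * (1/2) ^ m - 4 * (1/2) ^ N"
    by blast
  have "d (g x) (f x) \<le> 5 * (1/2) ^ m" if "m \<le> N" "x \<in> C m" for m x
  proof -
    have "0 \<le> (1/2 :: real) ^ N"
      by simp
    with g(2)[OF that] show ?thesis
      by linarith
  qed
  with g(1) show ?thesis
    unfolding C_def by blast
qed

end

section \<open>Locally constant approximations\<close>

text \<open>A small base element \<open>B\<close> is replaced by \<open>U k B \<inter> f -` N (c B)\<close>, which contains it, is
  functionally \<open>F\<^sub>\<sigma>\<close> and still lies in the discrete family of the \<open>U k B\<close>; on \<open>U k B\<close> the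
  approximating map is constantly \<open>c B\<close>.\<close>
lemma (in Metric_space) countable_locally_constant_approximation:
  assumes K: "f \<in> K1 X mtopology" and S: "f \<in> Sigma_f X mtopology"
    and lpc: "locally_path_connected_space mtopology" and e: "0 < e"
  obtains T V :: "nat \<Rightarrow> 'b set" and z where
    "\<And>k. functionally_Fsigma X (T k)" "\<And>k. functionally_open X (V k)"
    "\<And>k. locally_constant_on X (V k) (z k)" "\<And>k. T k \<subseteq> V k"
    "\<And>k x. x \<in> T k \<Longrightarrow> path_close e (z k x) (f x)" "topspace X \<subseteq> (\<Union>k. T k)"
proof -
  have f: "f \<in> topspace X \<rightarrow> M"
    using K by (simp add: K1_def)
  obtain \<B> where \<B>: "sigma_sfd X \<B>" "base_for X mtopology f \<B>"
    using S unfolding Sigma_f_def by blast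
  obtain \<F> :: "nat \<Rightarrow> 'b set set" where \<F>: "\<And>k. sfd X (\<F> k)" "\<B> = (\<Union>k. \<F> k)"
    using \<B>(1) unfolding sigma_sfd_def by blast
  have "\<forall>k. \<exists>U. discrete_family X U (\<F> k) \<and>
      (\<forall>B\<in>\<F> k. functionally_open X (U B) \<and> X closure_of B \<subseteq> U B)"
    using \<F>(1) unfolding sfd_def sfd_family_def by simp
  from choice[OF this] obtain U where U0: "\<forall>k. discrete_family X (U k) (\<F> k) \<and>
      (\<forall>B\<in>\<F> k. functionally_open X (U k B) \<and> X closure_of B \<subseteq> U k B)"
    by (rule exE)
  then have U: "discrete_family X (U k) (\<F> k)" "B \<in> \<F> k \<Longrightarrow> functionally_open X (U k B)"
    "B \<in> \<F> k \<Longrightarrow> X closure_of B \<subseteq> U k B" for k B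
    by simp_all
  have "\<forall>y\<in>M. \<exists>N. openin mtopology N \<and> y \<in> N \<and> (\<forall>a\<in>N. \<forall>b\<in>N. path_close e a b)"
    using path_close_neighbourhood[OF lpc _ e] by metis
  from bchoice[OF this] obtain N where N0:
    "\<forall>y\<in>M. openin mtopology (N y) \<and> y \<in> N y \<and> (\<forall>a\<in>N y. \<forall>b\<in>N y. path_close e a b)"
    by (rule exE)
  then have N: "openin mtopology (N y)" "y \<in> N y" "a \<in> N y \<Longrightarrow> b \<in> N y \<Longrightarrow> path_close e a b"
    if "y \<in> M" for y a b
    using that by simp_all
  define small where "small B y \<longleftrightarrow> y \<in> M \<and> B \<subseteq> {x \<in> topspace X. f x \<in> N y}" for B y
  define I where "I k = {B \<in> \<F> k. \<exists>y. small B y}" for k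
  define c where "c B = (SOME y. small B y)" for B
  have c: "small B (c B)" if "B \<in> I k" for B k
    using that unfolding c_def I_def by (auto intro: someI_ex)
  have disc: "discrete_family X (U k) (I k)" for k
    by (rule discrete_family_mono[OF U(1)]) (auto simp: I_def)
  have UI: "functionally_open X (U k B)" if "B \<in> I k" for k B
    using that U(2) by (simp add: I_def)
  have UX: "U k B \<subseteq> topspace X" if "B \<in> I k" for k B
    using UI[OF that] by (simp add: functionally_open_def)
  define V where "V k = (\<Union>B\<in>I k. U k B)" for k
  define z where "z k x = c (THE B. B \<in> I k \<and> x \<in> U k B)" for k x
  have z: "z k x = c B" if "B \<in> I k" "x \<in> U k B" for k x B
  proof -
    have "(THE B. B \<in> I k \<and> x \<in> U k B) = B"
    proof (rule the_equality)
      show "B' = B" if "B' \<in> I k \<and> x \<in> U k B'" for B'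
        using discrete_family_unique[OF disc, of x B' k B] subsetD[OF UX[OF \<open>B \<in> I k\<close>] \<open>x \<in> U k B\<close>]
          that \<open>B \<in> I k\<close> \<open>x \<in> U k B\<close> by simp
    qed (use that in simp)
    then show ?thesis
      by (simp add: z_def)
  qed
  define T where "T k = {x \<in> V k. f x \<in> N (z k x)}" for k
  show thesis
  proof (rule that[of T V z])
    show "T k \<subseteq> V k" for k
      by (auto simp: T_def)
    show "functionally_open X (V k)" for k
    proof -
      \<comment> \<open>Empty sets serve as the closed cores here, since only the union of the open
        sets is wanted.\<close>
      have "functionally_closed X {}"
        using functionally_closed_UN_finite[of "{}" X] by simp
      then show ?thesis
        unfolding V_def by (intro discrete_union_separation(2)[OF disc UI, where F="\<lambda>_. {}"]) auto
    qed
    show "locally_constant_on X (V k) (z k)" for k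
      unfolding locally_constant_on_def
    proof
      fix P
      have "{x \<in> V k. P (z k x)} = (\<Union>B\<in>{B \<in> I k. P (c B)}. U k B)"
        using z by (auto simp: V_def)
      then show "openin X {x \<in> V k. P (z k x)}"
        using functionally_open_imp_openin[OF UI] by auto
    qed
    show "path_close e (z k x) (f x)" if x: "x \<in> T k" for k x
    proof -
      obtain B where B: "B \<in> I k" "x \<in> U k B"
        using x by (auto simp: T_def V_def)
      have "c B \<in> M"
        using c[OF B(1)] by (simp add: small_def)
      then show ?thesis
        using N(2,3)[of "c B"] x z[OF B] by (auto simp: T_def)
    qed
    show "topspace X \<subseteq> (\<Union>k. T k)"
    proof
      fix x assume x: "x \<in> topspace X"
      then have fx: "f x \<in> M"
        using f by auto
      obtain \<C> where \<C>: "\<C> \<subseteq> \<B>" "{y \<in> topspace X. f y \<in> N (f x)} = \<Union>\<C>"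
        using \<B>(2) N(1)[OF fx] unfolding base_for_def by blast
      then obtain B k where B: "x \<in> B" "B \<in> \<F> k" "B \<subseteq> {y \<in> topspace X. f y \<in> N (f x)}"
        using x N(2)[OF fx] \<F>(2) by blast
      have BI: "B \<in> I k"
        using B fx by (auto simp: I_def small_def)
      have "x \<in> U k B"
        using U(3)[OF B(2)] closure_of_subset_Int[of X B] x B(1) by blast
      moreover have "f x \<in> N (c B)"
        using c[OF BI] B(1) by (auto simp: small_def)
      ultimately have "x \<in> T k"
        using BI z by (auto simp: T_def V_def)
      then show "x \<in> (\<Union>k. T k)" by blast
    qed
    show "functionally_Fsigma X (T k)" for k
    proof -
      have "functionally_Fsigma X (U k B \<inter> {x \<in> topspace X. f x \<in> N (c B)})" if "B \<in> I k" for B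
      proof (rule functionally_Fsigma_Int[OF functionally_open_imp_Fsigma[OF UI[OF that]]])
        have "c B \<in> M"
          using c[OF that] by (simp add: small_def)
        from N(1)[OF this] show "functionally_Fsigma X {x \<in> topspace X. f x \<in> N (c B)}"
          using K by (simp add: K1_def)
      qed
      then have "\<forall>B\<in>I k. \<exists>F :: nat \<Rightarrow> 'b set. (\<forall>j. functionally_closed X (F j)) \<and>
          U k B \<inter> {x \<in> topspace X. f x \<in> N (c B)} = (\<Union>j. F j)"
        unfolding functionally_Fsigma_def by blast
      from bchoice[OF this] obtain F where F0: "\<forall>B\<in>I k. (\<forall>j :: nat. functionally_closed X (F B j)) \<and>
          U k B \<inter> {x \<in> topspace X. f x \<in> N (c B)} = (\<Union>j. F B j)"
        by (rule exE)
      then have F: "functionally_closed X (F B j)" "U k B \<inter> {x \<in> topspace X. f x \<in> N (c B)} = (\<Union>j. F B j)"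
        if "B \<in> I k" for B j
        using that by simp_all
      \<comment> \<open>Exchanging the unions is the point: for fixed \<open>j\<close> there is one
        closed set inside each member of a discrete family, so their union is functionally closed,
        and only a countable union over \<open>j\<close> remains.\<close>
      have "T k = (\<Union>B\<in>I k. U k B \<inter> {x \<in> topspace X. f x \<in> N (c B)})"
        using z UX by (fastforce simp: T_def V_def)
      also have "\<dots> = (\<Union>B\<in>I k. \<Union>j. F B j)"
        using F(2) by simp
      also have "\<dots> = (\<Union>j. \<Union>B\<in>I k. F B j)"
        by blast
      finally have "T k = (\<Union>j. \<Union>B\<in>I k. F B j)" .
      moreover have "functionally_closed X (\<Union>B\<in>I k. F B j)" for j
      proof (rule discrete_union_separation(1)[OF disc UI F(1)])
        show "F B j \<subseteq> U k B" if "B \<in> I k" for B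
          using F(2)[OF that] by blast
      qed
      ultimately show ?thesis
        by (simp only:) (intro functionally_Fsigma_UN functionally_closed_imp_Fsigma)
    qed
  qed
qed

text \<open>The differences \<open>C k - (\<Union>j<k. C j)\<close> partition the space. With \<open>h k\<close> vanishing exactly on
  \<open>C k\<close>, shrinking them to \<open>\<forall>j<k. h j x \<ge> 1 / (n + 1)\<close> makes them functionally closed with
  disjoint functionally open neighbourhoods, on which the maps \<open>z k\<close> can be glued.\<close>
lemma merge_countable_cover:
  fixes C V :: "nat \<Rightarrow> 'a set"
  assumes C: "\<And>k. functionally_closed X (C k)" and V: "\<And>k. functionally_open X (V k)"
    and z: "\<And>k. locally_constant_on X (V k) (z k)" and CV: "\<And>k. C k \<subseteq> V k"
    and R: "\<And>k x. x \<in> C k \<Longrightarrow> R x (z k x)" and cover: "topspace X \<subseteq> (\<Union>k. C k)"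
  obtains D U :: "nat \<Rightarrow> 'a set" and w where
    "\<And>n. functionally_closed X (D n)" "\<And>n. functionally_open X (U n)"
    "\<And>n. locally_constant_on X (U n) (w n)" "\<And>n. D n \<subseteq> U n"
    "\<And>n x. x \<in> D n \<Longrightarrow> R x (w n x)" "\<And>x. x \<in> topspace X \<Longrightarrow> \<forall>\<^sub>F n in sequentially. x \<in> D n"
proof -
  have "\<exists>h. continuous_map X euclideanreal h \<and> (\<forall>x\<in>topspace X. 0 \<le> h x) \<and>
      C k = {x \<in> topspace X. h x = 0}" for k
    using functionally_closedE[OF C[of k]] by metis
  then have "\<forall>k. \<exists>h. continuous_map X euclideanreal h \<and> (\<forall>x\<in>topspace X. 0 \<le> h x) \<and>
      C k = {x \<in> topspace X. h x = 0}"
    by (rule allI)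
  from choice[OF this] obtain h where h0: "\<forall>k. continuous_map X euclideanreal (h k) \<and>
      (\<forall>x\<in>topspace X. 0 \<le> h k x) \<and> C k = {x \<in> topspace X. h k x = 0}"
    by (rule exE)
  then have h: "continuous_map X euclideanreal (h k)" "x \<in> topspace X \<Longrightarrow> 0 \<le> h k x"
    "C k = {x \<in> topspace X. h k x = 0}" for k x
    by blast+
  define \<delta> where "\<delta> n = 1 / real (Suc n)" for n
  have \<delta>: "0 < \<delta> n" for n
    by (simp add: \<delta>_def)
  define E where "E n k = C k \<inter> (topspace X \<inter> (\<Inter>j\<in>{..<k}. {x \<in> topspace X. \<delta> n \<le> h j x}))" for n k
  define G where "G n k = (V k \<inter> {x \<in> topspace X. - (\<delta> n / 2) < - h k x}) \<inter>
      (\<Inter>j\<in>{..<k}. {x \<in> topspace X. \<delta> n / 2 < h j x})" for n k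
  \<comment> \<open>On \<open>G n k\<close> the function \<open>h k\<close> is below \<delta> / 2
    and all earlier ones are above it, so the least index recovers \<open>k\<close>. This makes the
    sets \<open>G n k\<close> disjoint for fixed \<open>n\<close> and glues the maps by a single
    formula.\<close>
  define w where "w n x = z (LEAST k. h k x < \<delta> n / 2) x" for n x
  have "functionally_closed X (E n k)" for n k
    unfolding E_def
    by (intro functionally_closed_Int C functionally_closed_INT_finite functionally_closed_ge h) simp
  moreover have G: "functionally_open X (G n k)" for n k
    unfolding G_def
    by (intro functionally_open_Int V functionally_open_INT_finite functionally_open_gr
        continuous_map_minus h) simp
  moreover have EG: "E n k \<subseteq> G n k" for n k
    using CV[of k] \<delta>[of n] by (force simp: E_def G_def h(3))
  have w: "w n x = z k x" if "x \<in> G n k" for n k x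
  proof -
    have "(LEAST k. h k x < \<delta> n / 2) = k"
    proof (rule Least_equality)
      show "h k x < \<delta> n / 2"
        using that by (simp add: G_def)
      show "k \<le> j" if "h j x < \<delta> n / 2" for j
        using that \<open>x \<in> G n k\<close> by (force simp: G_def not_le[symmetric])
    qed
    then show ?thesis
      by (simp add: w_def)
  qed
  \<comment> \<open>Cutting the union at k \<le> n keeps it finite and hence functionally closed;
    nothing is lost as \<open>n\<close> grows, since each point needs only one index
    \<open>k\<close>.\<close>
  show thesis
  proof (rule that[of "\<lambda>n. \<Union>k\<in>{..n}. E n k" "\<lambda>n. \<Union>k\<in>{..n}. G n k" w])
    show "functionally_closed X (\<Union>k\<in>{..n}. E n k)" for n
      by (intro functionally_closed_UN_finite) (simp_all add: calculation)
    show "functionally_open X (\<Union>k\<in>{..n}. G n k)" for n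
      by (intro functionally_open_UN_finite G) simp
    show "(\<Union>k\<in>{..n}. E n k) \<subseteq> (\<Union>k\<in>{..n}. G n k)" for n
      using EG by blast
    show "R x (w n x)" if x: "x \<in> (\<Union>k\<in>{..n}. E n k)" for n x
    proof -
      obtain k where "x \<in> E n k"
        using x by blast
      then show ?thesis
        using w[OF subsetD[OF EG \<open>x \<in> E n k\<close>]] R[of x k] by (simp add: E_def)
    qed
    show "locally_constant_on X (\<Union>k\<in>{..n}. G n k) (w n)" for n
      unfolding locally_constant_on_def
    proof
      fix P
      have "{x \<in> (\<Union>k\<in>{..n}. G n k). P (w n x)} = (\<Union>k\<in>{..n}. G n k \<inter> {x \<in> V k. P (z k x)})"
        using w by (auto simp: G_def)
      then show "openin X {x \<in> (\<Union>k\<in>{..n}. G n k). P (w n x)}"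
        using functionally_open_imp_openin[OF G] locally_constant_onD[OF z]
        by (auto intro!: openin_Union openin_Int)
    qed
    show "\<forall>\<^sub>F n in sequentially. x \<in> (\<Union>k\<in>{..n}. E n k)" if x: "x \<in> topspace X" for x
    proof -
      \<comment> \<open>For the first \<open>k\<close> with \<open>x\<close> in \<open>C k\<close>,
        the finitely many values \<open>h j x\<close> with j < k are positive, so \<delta> n
        eventually falls below all of them.\<close>
      define k where "k = (LEAST k. x \<in> C k)"
      have k: "x \<in> C k"
      proof -
        have "\<exists>k. x \<in> C k"
          using subsetD[OF cover x] by simp
        then show ?thesis
          unfolding k_def by (rule LeastI_ex)
      qed
      have pos: "0 < h j x" if "j < k" for j
        using not_less_Least[of j "\<lambda>k. x \<in> C k"] that h(2)[OF x, of j] x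
        by (simp add: k_def h(3) less_le)
      have "\<delta> \<longlonglongrightarrow> 0"
        unfolding \<delta>_def using LIMSEQ_inverse_real_of_nat by (simp add: inverse_eq_divide)
      then have "\<forall>\<^sub>F n in sequentially. \<delta> n < h j x" if "j < k" for j
        using order_tendstoD(2) pos[OF that] by blast
      then have "\<forall>\<^sub>F n in sequentially. \<forall>j\<in>{..<k}. \<delta> n < h j x"
        by (intro eventually_ball_finite) auto
      with eventually_ge_at_top[of k] show ?thesis
      proof eventually_elim
        case (elim n)
        have "x \<in> E n k"
          unfolding E_def using k x elim(2) by (simp add: less_imp_le)
        with elim(1) show ?case
          by blast
      qed
    qed
  qed
qed

text \<open>The functionally closed pieces of all \<open>T k\<close> form one sequence, each piece
  inheriting the neighbourhood and the map of its own \<open>T k\<close>; the same neighbourhood may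
  thus occur many times.\<close>

lemma merge_countable_Fsigma_cover:
  fixes T V :: "nat \<Rightarrow> 'a set"
  assumes T: "\<And>k. functionally_Fsigma X (T k)" and V: "\<And>k. functionally_open X (V k)"
    and z: "\<And>k. locally_constant_on X (V k) (z k)" and TV: "\<And>k. T k \<subseteq> V k"
    and R: "\<And>k x. x \<in> T k \<Longrightarrow> R x (z k x)" and cover: "topspace X \<subseteq> (\<Union>k. T k)"
  obtains D U :: "nat \<Rightarrow> 'a set" and w where
    "\<And>n. functionally_closed X (D n)" "\<And>n. functionally_open X (U n)"
    "\<And>n. locally_constant_on X (U n) (w n)" "\<And>n. D n \<subseteq> U n"
    "\<And>n x. x \<in> D n \<Longrightarrow> R x (w n x)" "\<And>x. x \<in> topspace X \<Longrightarrow> \<forall>\<^sub>F n in sequentially. x \<in> D n"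
proof -
  have "\<forall>k. \<exists>F :: nat \<Rightarrow> 'a set. (\<forall>j. functionally_closed X (F j)) \<and> T k = (\<Union>j. F j)"
    using T unfolding functionally_Fsigma_def by blast
  from choice[OF this] obtain F
    where "\<forall>k. (\<forall>j :: nat. functionally_closed X (F k j)) \<and> T k = (\<Union>j. F k j)" by (rule exE)
  then have F: "functionally_closed X (F k j)" "T k = (\<Union>j. F k j)" for k j
    by simp_all
  define p where "p i = fst (prod_decode i)" for i
  define C where "C i = F (p i) (snd (prod_decode i))" for i
  have CT: "C i \<subseteq> T (p i)" for i
    by (auto simp: C_def F(2)[of "p i"])
  have C: "functionally_closed X (C i)" for i
    by (simp add: C_def F)
  have CV: "C i \<subseteq> V (p i)" for i
    using CT TV by blast
  have CR: "R x (z (p i) x)" if "x \<in> C i" for i x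
    using CT R that by blast
  have cover': "topspace X \<subseteq> (\<Union>i. C i)"
  proof
    fix x assume "x \<in> topspace X"
    then obtain k j where "x \<in> F k j"
      using cover F(2) by blast
    then show "x \<in> (\<Union>i. C i)"
      by (intro UN_I[of "prod_encode (k, j)"]) (auto simp: C_def p_def)
  qed
  show thesis
    by (rule merge_countable_cover[of X C "\<lambda>i. V (p i)" "\<lambda>i. z (p i)" R, OF C V z CV CR cover'])
      (assumption, rule that)
qed

section \<open>From arcs to paths, and convergence of the corrected maps\<close>

text \<open>An embedding of the unit interval is in particular a path. Equal points, for which the
  arc condition says nothing, are joined by a constant path.\<close>

lemma locally_arc_connected_imp_locally_path_connected:
  assumes "locally_arc_connected_space Y"
  shows "locally_path_connected_space Y"
proof -
  have "path_connectedin Y S" if S: "arc_connectedin Y S" for S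
  proof -
    have "\<exists>g. pathin (subtopology Y S) g \<and> g 0 = x \<and> g 1 = y"
      if xy: "x \<in> topspace (subtopology Y S)" "y \<in> topspace (subtopology Y S)" for x y
    proof (cases "x = y")
      case True
      then show ?thesis
        using xy by (intro exI[of _ "\<lambda>_. x"]) (simp only: pathin_const)
    next
      case False
      then obtain g where g: "arcin (subtopology Y S) g" "g 0 = x" "g 1 = y"
        using S xy unfolding arc_connectedin_def arc_connected_space_def by blast
      have "pathin (subtopology Y S) g"
        using homeomorphic_imp_continuous_map[OF g(1)[unfolded arcin_def embedding_map_def]]
        unfolding pathin_def by (rule continuous_map_into_fulltopology)
      with g(2,3) show ?thesis
        by blast
    qed
    with S show ?thesis
      unfolding path_connectedin_def path_connected_space_def arc_connectedin_def by blast
  qed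
  with assms show ?thesis
    unfolding locally_path_connected_space_def locally_arc_connected_space_def
    using neighbourhood_base_of_mono by blast
qed

text \<open>The bound 1 on the metric, together with path connectedness, makes the whole space a
  witness that any two points are path close at scale 2^0, which starts the corrections.\<close>

lemma (in Metric_space) K1_Int_Sigma_f_subset_B1:
  assumes bound: "\<And>x y. x \<in> M \<Longrightarrow> y \<in> M \<Longrightarrow> d x y \<le> 1"
    and pc: "path_connected_space mtopology" and lpc: "locally_path_connected_space mtopology"
  shows "K1 X mtopology \<inter> Sigma_f X mtopology \<subseteq> B1 X mtopology"
proof
  fix f assume fKS: "f \<in> K1 X mtopology \<inter> Sigma_f X mtopology"
  then have f: "f \<in> topspace X \<rightarrow> M"
    by (simp add: K1_def)
  show "f \<in> B1 X mtopology"
  proof (cases "topspace X = {}")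
    case True
    then show ?thesis
      using f by (auto simp: B1_def continuous_map_def intro!: exI[of _ "\<lambda>_. f"])
  next
    case False
    then obtain y0 where y0: "y0 \<in> M"
      using f by blast
    have y0_close: "path_close 1 y0 y" if "y \<in> M" for y
      unfolding path_close_def using y0 that bound pc path_connectedin_topspace[of mtopology]
      by (intro exI[of _ M]) simp
    \<comment> \<open>The three sequences for a scale are packed into a triple so that one
      application of choice covers all scales.\<close>
    have "\<forall>m. \<exists>DUw :: (nat \<Rightarrow> _ set) \<times> (nat \<Rightarrow> _ set) \<times> (nat \<Rightarrow> _ \<Rightarrow> 'a). case DUw of (D, U, w) \<Rightarrow>
        (\<forall>n. functionally_closed X (D n)) \<and> (\<forall>n. functionally_open X (U n)) \<and>
        (\<forall>n. locally_constant_on X (U n) (w n)) \<and> (\<forall>n. D n \<subseteq> U n) \<and>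
        (\<forall>n. \<forall>x\<in>D n. path_close ((1/2) ^ Suc m) (w n x) (f x)) \<and>
        (\<forall>x\<in>topspace X. \<forall>\<^sub>F n in sequentially. x \<in> D n)"
    proof
      fix m
      have pos: "0 < (1/2 :: real) ^ Suc m"
        by simp
      obtain T V z where TV:
        "\<And>k. functionally_Fsigma X (T k)" "\<And>k. functionally_open X (V k)"
        "\<And>k. locally_constant_on X (V k) (z k)" "\<And>k. T k \<subseteq> V k"
        "\<And>k x. x \<in> T k \<Longrightarrow> path_close ((1/2) ^ Suc m) (z k x) (f x)"
        "topspace X \<subseteq> (\<Union>k :: nat. T k)"
        using countable_locally_constant_approximation[OF _ _ lpc pos] fKS by blast
      obtain D U w where D: "\<And>n. functionally_closed X (D n)" "\<And>n. functionally_open X (U n)"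
        "\<And>n. locally_constant_on X (U n) (w n)" "\<And>n :: nat. D n \<subseteq> U n"
        "\<And>n x. x \<in> D n \<Longrightarrow> path_close ((1/2) ^ Suc m) (w n x) (f x)"
        "\<And>x. x \<in> topspace X \<Longrightarrow> \<forall>\<^sub>F n in sequentially. x \<in> D n"
        using merge_countable_Fsigma_cover[of X T V z "\<lambda>x y. path_close ((1/2) ^ Suc m) y (f x)", OF TV]
        by blast
      then show "\<exists>DUw :: (nat \<Rightarrow> _ set) \<times> (nat \<Rightarrow> _ set) \<times> (nat \<Rightarrow> _ \<Rightarrow> 'a). case DUw of (D, U, w) \<Rightarrow>
        (\<forall>n. functionally_closed X (D n)) \<and> (\<forall>n. functionally_open X (U n)) \<and>
        (\<forall>n. locally_constant_on X (U n) (w n)) \<and> (\<forall>n. D n \<subseteq> U n) \<and>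
        (\<forall>n. \<forall>x\<in>D n. path_close ((1/2) ^ Suc m) (w n x) (f x)) \<and>
        (\<forall>x\<in>topspace X. \<forall>\<^sub>F n in sequentially. x \<in> D n)"
        by (intro exI[of _ "(D, U, w)"]) simp
    qed
    from choice[OF this] obtain DUw where DUw: "\<forall>m. case DUw m of (D, U, w) \<Rightarrow>
        (\<forall>n. functionally_closed X (D n)) \<and> (\<forall>n. functionally_open X (U n)) \<and>
        (\<forall>n. locally_constant_on X (U n) (w n)) \<and> (\<forall>n. D n \<subseteq> U n) \<and>
        (\<forall>n. \<forall>x\<in>D n. path_close ((1/2) ^ Suc m) (w n x) (f x)) \<and>
        (\<forall>x\<in>topspace X. \<forall>\<^sub>F n :: nat in sequentially. x \<in> D n)"
      by (rule exE)
    define D where "D m = fst (DUw m)" for m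
    define U where "U m = fst (snd (DUw m))" for m
    define w where "w m = snd (snd (DUw m))" for m
    have D: "functionally_closed X (D m n)" "functionally_open X (U m n)"
      "locally_constant_on X (U m n) (w m n)" "D m n \<subseteq> U m n"
      "x \<in> D m n \<Longrightarrow> path_close ((1/2) ^ Suc m) (w m n x) (f x)"
      "x \<in> topspace X \<Longrightarrow> \<forall>\<^sub>F n in sequentially. x \<in> D m n" for m n x
      using DUw[rule_format, of m] by (simp_all add: D_def U_def w_def split_beta)
    have "\<forall>n. \<exists>g. continuous_map X mtopology g \<and>
        (\<forall>m\<le>n. \<forall>x\<in>topspace X \<inter> (\<Inter>l\<in>{..<m}. D l n). d (g x) (f x) \<le> 5 * (1/2) ^ m)"
    proof
      fix n
      show "\<exists>g. continuous_map X mtopology g \<and>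
        (\<forall>m\<le>n. \<forall>x\<in>topspace X \<inter> (\<Inter>l\<in>{..<m}. D l n). d (g x) (f x) \<le> 5 * (1/2) ^ m)"
        by (rule approximate_on_nested[OF f y0_close y0, where U="\<lambda>l. U l n" and z="\<lambda>l. w l n"])
          (use D(1-5) in auto)
    qed
    from choice[OF this] obtain g where g0: "\<forall>n. continuous_map X mtopology (g n) \<and>
        (\<forall>m\<le>n. \<forall>x\<in>topspace X \<inter> (\<Inter>l\<in>{..<m}. D l n). d (g n x) (f x) \<le> 5 * (1/2) ^ m)"
      by (rule exE)
    then have g: "continuous_map X mtopology (g n)" for n
      by simp
    have gf: "d (g n x) (f x) \<le> 5 * (1/2) ^ m"
      if "m \<le> n" "x \<in> topspace X" "\<forall>l\<in>{..<m}. x \<in> D l n" for m n x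
      using g0 that by simp
    have "limitin mtopology (\<lambda>n. g n x) (f x) sequentially" if x: "x \<in> topspace X" for x
      unfolding limitin_metric
    proof (intro conjI allI impI)
      show "f x \<in> M"
        using f x by auto
      fix \<epsilon> :: real assume "0 < \<epsilon>"
      then obtain m where m: "(1/2) ^ m < \<epsilon> / 5"
        using real_arch_pow_inv[of "\<epsilon> / 5" "1/2"] by auto
      \<comment> \<open>For fixed \<open>m\<close> only finitely many scales matter, so the moments
        from which \<open>x\<close> stays in each \<open>D l n\<close> have a common upper
        bound.\<close>
      have "\<forall>\<^sub>F n in sequentially. \<forall>l\<in>{..<m}. x \<in> D l n"
        using D(6)[OF x] by (intro eventually_ball_finite) auto
      with eventually_ge_at_top[of m]
      show "\<forall>\<^sub>F n in sequentially. g n x \<in> M \<and> d (g n x) (f x) < \<epsilon>"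
      proof eventually_elim
        case (elim n)
        then have "d (g n x) (f x) < \<epsilon>"
          using gf[OF elim(1) x elim(2)] m by simp
        then show ?case
          using continuous_map_funspace[OF g] x by auto
      qed
    qed
    with f g show ?thesis
      unfolding B1_def by auto
  qed
qed

theorem mainTheorem7:
  fixes X :: "'a topology" and Y :: "'b topology"
  assumes "metrizable_space Y"
    and "connected_space Y"
    and "locally_arc_connected_space Y"
  shows "K1 X Y \<inter> Sigma_f X Y = B1 X Y"
proof -
  obtain M d where "Metric_space M d" and Y: "Y = Metric_space.mtopology M d"
    using assms(1) unfolding metrizable_space_def by blast
  then interpret Metric_space M d by simp
  \<comment> \<open>Capping the metric at 1 keeps the topology and provides the bound on distances
    that the starting constant map requires.\<close>
  interpret C: Metric_space M "capped_dist 1"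
    by (rule capped_dist)
  have YC: "Y = C.mtopology"
    by (simp add: Y mtopology_capped_metric)
  have lpc: "locally_path_connected_space Y"
    using assms(3) by (rule locally_arc_connected_imp_locally_path_connected)
  then have "path_connected_space Y"
    using assms(2) path_connected_eq_connected_space by blast
  with lpc have "K1 X Y \<inter> Sigma_f X Y \<subseteq> B1 X Y"
    unfolding YC by (intro C.K1_Int_Sigma_f_subset_B1) (simp_all add: capped_dist_def)
  with B1_subset_K1[OF assms(1)] B1_subset_Sigma_f[OF assms(1)] show ?thesis
    by blast
qed

end
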